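(* Let $X=\{1,2\}$, $\Omega=\{1,2\}^{\mathbb{N}}$, and let $\mu=(p,1-p)$, where $0\le p\le 1$, be a probability on $X$. Suppose $c:X\times\Omega\to\mathbb{R}$ is a Lipschitz cost that depends on $x$ and just on the two first coordinates of $y$, $c(x,y)=c(x,y_1,y_2)$. For $x\in\{1,2\}$ let $C^x$ be the $2\times2$ matrix with entries $C^x_{ij}=e^{c(x,i,j)}$, and let $$C^{12}=\begin{pmatrix}C^1_{11}&C^1_{12}\\ C^2_{21}&C^2_{22}\end{pmatrix},\qquad C^{21}=\begin{pmatrix}C^2_{11}&C^2_{12}\\ C^1_{21}&C^1_{22}\end{pmatrix}.$$ Consider the duality equation $$\inf_{\varphi:X\to\mathbb{R},\ P(c-\varphi)=0}\int_X\varphi\,d\mu=\sup_{\pi\in\Pi(\mu,\sigma)}\left(\int_{X\times\Omega}c\,d\pi+H(\pi)\right).\qquad( * )$$ (a) The unique minimizer $\tilde\varphi=(\tilde\varphi_1,\tilde\varphi_2)$ of the left-hand side of $( * )$ is given by $$\tilde\varphi_1=-\log z_1,\qquad \tilde\varphi_2=-\log z_2,$$ where $(z_1,z_2)$ belongs to the set of positive solutions of the system of equations $$\begin{cases}a z_1^2+b z_2^2+\gamma z_1z_2+\delta z_1+\epsilon z_2+1=0,\\ 2bp z_2^2-2a(1-p)z_1^2+\gamma(2p-1)z_1z_2+\epsilon p z_2-\delta(1-p)z_1=0,\end{cases}$$ with $a=\det C^1$, $b=\det C^2$, $\gamma=\det C^{12}+\det C^{21}$, $\delta=-\operatorname{tr}C^1$,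 $\epsilon=-\operatorname{tr}C^2$. This means that $(z_1,z_2)$ belongs to the set of intersection points of the two conics given by these equations. Such intersection points are four, at most, and $(z_1,z_2)$ is the one that minimizes $-p\log z_1-(1-p)\log z_2$. (b) Suppose also that $C^1$ and $C^2$ are stochastic matrices (each column of each matrix sums to $1$). Then the unique minimizer $\tilde\varphi$ of the left-hand side of $( * )$ is given by $$\tilde\varphi_1=-\log p,\qquad\tilde\varphi_2=-\log(1-p).$$ Also, $$\sup_{\pi\in\Pi(\mu,\sigma)}\left(\int_{X\times\Omega}c\,d\pi+H(\pi)\right)=-p\log p-(1-p)\log(1-p).$$
   Context: $\Omega$ is the Bernoulli space on two symbols with a usual metric $d_\theta(y,w)=\theta^{\min\{k:\,y_k\neq w_k\}}$, $0<\theta<1$; $\sigma:\Omega\to\Omega$ is the shift. A plan is a Borel probability measure on $X\times\Omega$. $\Pi(\cdot,\sigma)$ is the set of plans whose marginal on $\Omega$ is $\sigma$-invariant; $\Pi(\mu,\sigma)$ is the set of plans in $\Pi(\cdot,\sigma)$ whose marginal on $X$ is $\mu$. A function $\varphi:X\to\mathbb{R}$ is identified with the vector $(\varphi_1,\varphi_2)=(\varphi(1),\varphi(2))$, so $\int_X\varphi\,d\mu=p\varphi_1+(1-p)\varphi_2$, and $(c-\varphi)(x,y)=c(x,y)-\varphi(x)$. Entropy of a plan: let $\pi\in\Pi(\cdot,\sigma)$ have $\Omega$-marginal $\nu$. Put $J^n_\pi(x,y)=\dfrac{\pi([x,y_1\dots y_n])}{\nu([y_2\dots y_n])}$ when $(y_2,y_3,\dots)\in\operatorname{supp}\nu$,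 where $[x,y_1\dots y_n]=\{(\alpha,w)\in X\times\Omega:\alpha=x,\ w_1=y_1,\dots,w_n=y_n\}$ and $[y_2\dots y_n]=\{w\in\Omega:w_1=y_2,\dots,w_{n-1}=y_n\}$. The functions $J^n_\pi$ converge $\pi$-a.e. and in $L^1(\pi)$ to a function $J_\pi$, and $H(\pi)=-\int\log J_\pi\,d\pi$. Pressure: for a Lipschitz cost $c$, $P(c)=\sup_{\pi\in\Pi(\cdot,\sigma)}\left(\int_{X\times\Omega} c\,d\pi+H(\pi)\right)$.
   Formalization: The minimizer claims and "four, at most" are stated for 0<p<1 only (they fail at p=0,1); and (z1,z2) is the one minimizing -p log z1-(1-p) log z2 among the positive intersection points with P(c-φ)=0, since other intersection points can give a smaller value. *)

theory Defs
  imports "HOL-Probability.Probability"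
begin

text \<open>
  Both alphabets are the type \<^typ>\<open>2\<close> of HOL-Library.Numeral_Type, whose two elements are
  \<open>1\<close> and \<open>2\<close> (the latter equals \<open>0\<close>); matrices over it have type \<^typ>\<open>real^2^2\<close>.
  A point \<open>(y\<^sub>1, y\<^sub>2, \<dots>)\<close> of the Bernoulli space is a function on \<^typ>\<open>nat\<close> whose value at \<open>k\<close> is
  \<open>y\<^sub>k\<^sub>+\<^sub>1\<close>.
\<close>

type_synonym seq = "nat \<Rightarrow> 2"

definition shift :: "seq \<Rightarrow> seq" where
  "shift y = (\<lambda>k. y (Suc k))"

text \<open>The \<open>Suc\<close> accounts for the shift of indices described above.\<close>

definition seq_dist :: "real \<Rightarrow> seq \<Rightarrow> seq \<Rightarrow> real" where
  "seq_dist \<theta> y w = (if y = w then 0 else \<theta> ^ Suc (LEAST k. y k \<noteq> w k))"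

text \<open>Lipschitz with respect to the sum of the discrete metric and \<^const>\<open>seq_dist\<close>.\<close>

definition lipschitz_cost :: "real \<Rightarrow> (2 \<times> seq \<Rightarrow> real) \<Rightarrow> bool" where
  "lipschitz_cost \<theta> c \<longleftrightarrow>
     (\<exists>L. \<forall>x y x' y'. \<bar>c (x, y) - c (x', y')\<bar> \<le> L * ((if x = x' then 0 else 1) + seq_dist \<theta> y y'))"

definition seq_top :: "seq topology" where
  "seq_top = product_topology (\<lambda>_. discrete_topology UNIV) UNIV"

text \<open>The next two measures only serve to carry the Borel sigma-algebras of the two spaces;
  see \<open>sets_seq_space\<close> and \<open>sets_plan_space\<close> below.\<close>

definition seq_space :: "seq measure" where
  "seq_space = Pi\<^sub>M UNIV (\<lambda>_. count_space UNIV)"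

definition plan_space :: "(2 \<times> seq) measure" where
  "plan_space = count_space UNIV \<Otimes>\<^sub>M seq_space"

definition marginal_seq :: "(2 \<times> seq) measure \<Rightarrow> seq measure" where
  "marginal_seq \<pi> = distr \<pi> seq_space snd"

definition marginal_symbol :: "(2 \<times> seq) measure \<Rightarrow> 2 measure" where
  "marginal_symbol \<pi> = distr \<pi> (count_space UNIV) fst"

definition plans :: "(2 \<times> seq) measure set" where
  "plans = {\<pi>. prob_space \<pi> \<and> sets \<pi> = sets plan_space}"

definition invariant_plans :: "(2 \<times> seq) measure set" where
  "invariant_plans =
     {\<pi> \<in> plans. distr (marginal_seq \<pi>) seq_space shift = marginal_seq \<pi>}"

definition invariant_plans_over :: "2 measure \<Rightarrow> (2 \<times> seq) measure set" where
  "invariant_plans_over \<mu> = {\<pi> \<in> invariant_plans. marginal_symbol \<pi> = \<mu>}"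

definition seq_support :: "seq measure \<Rightarrow> seq set" where
  "seq_support \<nu> = {y. \<forall>U. openin seq_top U \<and> y \<in> U \<longrightarrow> measure \<nu> U > 0}"

definition cylinder :: "nat \<Rightarrow> seq \<Rightarrow> seq set" where
  "cylinder n y = {w. \<forall>k<n. w k = y k}"

text \<open>
  The denominator is the mass of \<open>[y\<^sub>2 \<dots> y\<^sub>n]\<close>, and the condition says that \<open>(y\<^sub>2, y\<^sub>3, \<dots>)\<close> lies in the
  support of the marginal. For an invariant plan it holds almost everywhere, so the value \<open>0\<close>
  chosen outside is irrelevant; so is the value of \<^const>\<open>lim\<close> at points without convergence in the
  definition after it.
\<close>

definition jac_approx :: "(2 \<times> seq) measure \<Rightarrow> nat \<Rightarrow> 2 \<times> seq \<Rightarrow> real" where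
  "jac_approx \<pi> n = (\<lambda>(x, y).
     if shift y \<in> seq_support (marginal_seq \<pi>)
     then measure \<pi> ({x} \<times> cylinder n y) / measure (marginal_seq \<pi>) (cylinder (n - 1) (shift y))
     else 0)"

definition jac :: "(2 \<times> seq) measure \<Rightarrow> 2 \<times> seq \<Rightarrow> real" where
  "jac \<pi> z = lim (\<lambda>n. jac_approx \<pi> n z)"

definition plan_entropy :: "(2 \<times> seq) measure \<Rightarrow> real" where
  "plan_entropy \<pi> = - (\<integral>z. ln (jac \<pi> z) \<partial>\<pi>)"

text \<open>Suprema are taken in \<^typ>\<open>ereal\<close>, so that they are meaningful without a boundedness proof.\<close>

definition pressure :: "(2 \<times> seq \<Rightarrow> real) \<Rightarrow> ereal" where
  "pressure c = (SUP \<pi>\<in>invariant_plans. ereal ((\<integral>z. c z \<partial>\<pi>) + plan_entropy \<pi>))"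

definition constrained_pressure :: "2 measure \<Rightarrow> (2 \<times> seq \<Rightarrow> real) \<Rightarrow> ereal" where
  "constrained_pressure \<mu> c =
     (SUP \<pi>\<in>invariant_plans_over \<mu>. ereal ((\<integral>z. c z \<partial>\<pi>) + plan_entropy \<pi>))"

definition two_point_measure :: "real \<Rightarrow> 2 measure" where
  "two_point_measure p = point_measure UNIV (\<lambda>x. ennreal (if x = 1 then p else 1 - p))"

definition admissible :: "(2 \<times> seq \<Rightarrow> real) \<Rightarrow> (2 \<Rightarrow> real) \<Rightarrow> bool" where
  "admissible c \<phi> \<longleftrightarrow> pressure (\<lambda>(x, y). c (x, y) - \<phi> x) = 0"

text \<open>\<open>\<phi>\<close> is the unique minimizer of the left-hand side of the duality equation.\<close>

definition unique_dual_minimizer :: "2 measure \<Rightarrow> (2 \<times> seq \<Rightarrow> real) \<Rightarrow> (2 \<Rightarrow> real) \<Rightarrow> bool" where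
  "unique_dual_minimizer \<mu> c \<phi> \<longleftrightarrow>
     (\<forall>\<psi>. is_arg_min (\<lambda>\<phi>. \<integral>x. \<phi> x \<partial>\<mu>) (admissible c) \<psi> \<longleftrightarrow> \<psi> = \<phi>)"

definition neg_log_pair :: "real \<times> real \<Rightarrow> 2 \<Rightarrow> real" where
  "neg_log_pair z = (\<lambda>x. if x = 1 then - ln (fst z) else - ln (snd z))"

definition column_stochastic :: "real^2^2 \<Rightarrow> bool" where
  "column_stochastic A \<longleftrightarrow> (\<forall>i j. 0 \<le> A $ i $ j) \<and> (\<forall>j. (\<Sum>i\<in>UNIV. A $ i $ j) = 1)"


text \<open>The remaining facts justify \<^const>\<open>seq_top\<close>, \<^const>\<open>seq_space\<close> and \<^const>\<open>plan_space\<close>.\<close>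

lemma openin_seq_top: "openin seq_top U \<longleftrightarrow> (\<forall>y\<in>U. \<exists>n. cylinder n y \<subseteq> U)"
proof
  assume op: "openin seq_top U"
  show "\<forall>y\<in>U. \<exists>n. cylinder n y \<subseteq> U"
  proof
    fix y assume "y \<in> U"
    then obtain V where V: "finite {i. V i \<noteq> (UNIV :: 2 set)}" "y \<in> Pi\<^sub>E UNIV V" "Pi\<^sub>E UNIV V \<subseteq> U"
      using op unfolding seq_top_def openin_product_topology_alt by fastforce
    then obtain n where n: "\<And>i. V i \<noteq> UNIV \<Longrightarrow> i < n"
      using finite_nat_set_iff_bounded by auto
    have "w i \<in> V i" if "w \<in> cylinder n y" for w i
      using that n[of i] V(2) by (cases "i < n") (auto simp: cylinder_def PiE_iff)
    then have "cylinder n y \<subseteq> U" using V(3) by auto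
    then show "\<exists>n. cylinder n y \<subseteq> U" ..
  qed
next
  assume R: "\<forall>y\<in>U. \<exists>n. cylinder n y \<subseteq> U"
  show "openin seq_top U"
    unfolding seq_top_def openin_product_topology_alt
  proof (intro ballI conjI allI impI)
    fix y assume "y \<in> U"
    then obtain n where n: "cylinder n y \<subseteq> U" using R by auto
    have fin: "finite {i::nat. (if i < n then {y i} else UNIV) \<noteq> UNIV}"
      by (rule finite_subset[of _ "{..<n}"]) auto
    have sub: "Pi\<^sub>E UNIV (\<lambda>i. if i < n then {y i} else UNIV) \<subseteq> U"
    proof
      fix w assume w: "w \<in> Pi\<^sub>E UNIV (\<lambda>i. if i < n then {y i} else UNIV)"
      have "w i = y i" if "i < n" for i
        using PiE_mem[OF w, of i] that by simp
      then show "w \<in> U" using n by (auto simp: cylinder_def)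
    qed
    show "\<exists>V. finite {i \<in> UNIV. V i \<noteq> topspace (discrete_topology UNIV)} \<and>
        (\<forall>i\<in>UNIV. openin (discrete_topology UNIV) (V i)) \<and> y \<in> Pi\<^sub>E UNIV V \<and> Pi\<^sub>E UNIV V \<subseteq> U"
      by (rule exI[of _ "\<lambda>i. if i < n then {y i} else UNIV"]) (use fin sub in auto)
  qed
qed

lemma seq_dist_less_iff:
  assumes "0 < \<theta>" "\<theta> < 1"
  shows "seq_dist \<theta> y w < \<theta> ^ n \<longleftrightarrow> w \<in> cylinder n y"
proof (cases "y = w")
  case False
  then have ex: "\<exists>k. y k \<noteq> w k" by auto
  have "seq_dist \<theta> y w < \<theta> ^ n \<longleftrightarrow> n < Suc (LEAST k. y k \<noteq> w k)"
    using False assms by (simp add: seq_dist_def power_strict_decreasing_iff del: power_Suc)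
  also have "\<dots> \<longleftrightarrow> w \<in> cylinder n y"
  proof
    assume le: "n < Suc (LEAST k. y k \<noteq> w k)"
    have "y i = w i" if "i < n" for i
      using not_less_Least[of i "\<lambda>k. y k \<noteq> w k"] that le by linarith
    then show "w \<in> cylinder n y" by (simp add: cylinder_def)
  next
    assume "w \<in> cylinder n y"
    then have "\<not> (LEAST k. y k \<noteq> w k) < n"
      using LeastI_ex[OF ex] by (auto simp: cylinder_def)
    then show "n < Suc (LEAST k. y k \<noteq> w k)" by simp
  qed
  finally show ?thesis .
qed (use assms in \<open>auto simp: seq_dist_def cylinder_def\<close>)

lemma Metric_space_seq_dist:
  assumes "0 < \<theta>" "\<theta> < 1"
  shows "Metric_space UNIV (seq_dist \<theta>)"
proof
  fix x y z :: seq
  show "0 \<le> seq_dist \<theta> x y" using assms by (simp add: seq_dist_def)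
  have "(\<lambda>k. x k \<noteq> y k) = (\<lambda>k. y k \<noteq> x k)" by auto
  then show "seq_dist \<theta> x y = seq_dist \<theta> y x" unfolding seq_dist_def by (cases "x = y") auto
  show "seq_dist \<theta> x y = 0 \<longleftrightarrow> x = y" using assms by (simp add: seq_dist_def)
  show "seq_dist \<theta> x z \<le> seq_dist \<theta> x y + seq_dist \<theta> y z"
  proof (cases "x = z")
    case False
    define m where "m = (LEAST k. x k \<noteq> z k)"
    have "\<exists>k. x k \<noteq> z k" using False by auto
    then have m: "x m \<noteq> z m" unfolding m_def by (rule LeastI_ex)
    have d: "seq_dist \<theta> x z = \<theta> ^ Suc m" using False by (simp add: seq_dist_def m_def)
    have "\<not> (y \<in> cylinder (Suc m) x \<and> z \<in> cylinder (Suc m) y)"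
      using m by (auto simp: cylinder_def)
    then have "\<theta> ^ Suc m \<le> seq_dist \<theta> x y \<or> \<theta> ^ Suc m \<le> seq_dist \<theta> y z"
      using assms by (metis not_le seq_dist_less_iff)
    moreover have "0 \<le> seq_dist \<theta> x y" "0 \<le> seq_dist \<theta> y z"
      using assms by (simp_all add: seq_dist_def)
    ultimately show ?thesis using d by linarith
  qed (use assms in \<open>simp add: seq_dist_def\<close>)
qed

lemma mtopology_seq_dist:
  assumes "0 < \<theta>" "\<theta> < 1"
  shows "Metric_space.mtopology UNIV (seq_dist \<theta>) = seq_top"
proof -
  interpret Metric_space UNIV "seq_dist \<theta>" using assms by (rule Metric_space_seq_dist)
  have ball: "mball y (\<theta> ^ n) = cylinder n y" for y n
    using seq_dist_less_iff[OF assms] by (auto simp: mball_def)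
  have "(\<exists>r>0. mball y r \<subseteq> U) \<longleftrightarrow> (\<exists>n. cylinder n y \<subseteq> U)" for y U
  proof
    assume "\<exists>r>0. mball y r \<subseteq> U"
    then obtain r where r: "r > 0" "mball y r \<subseteq> U" by auto
    obtain n where "\<theta> ^ n < r" using real_arch_pow_inv[of r \<theta>] r assms by auto
    then have "cylinder n y \<subseteq> mball y r" unfolding ball[symmetric] by (intro mball_subset_concentric) simp
    then show "\<exists>n. cylinder n y \<subseteq> U" using r by auto
  next
    assume "\<exists>n. cylinder n y \<subseteq> U"
    then show "\<exists>r>0. mball y r \<subseteq> U" using assms by (metis ball zero_less_power)
  qed
  then show ?thesis unfolding topology_eq openin_mtopology openin_seq_top by auto
qed

lemma countable_cylinders: "countable {cylinder n y | n y. True}"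
proof -
  have "{cylinder n y | n y. True} \<subseteq> (\<lambda>l. {w. \<forall>k<length l. w k = l ! k}) ` (UNIV :: 2 list set)"
  proof
    fix A assume "A \<in> {cylinder n y | n y. True}"
    then obtain n y where "A = cylinder n y" by auto
    then have "A = {w. \<forall>k<length (map y [0..<n]). w k = map y [0..<n] ! k}"
      by (auto simp: cylinder_def)
    then show "A \<in> (\<lambda>l. {w. \<forall>k<length l. w k = l ! k}) ` (UNIV :: 2 list set)" by blast
  qed
  then show ?thesis by (rule countable_subset) auto
qed

lemma cylinder_in_sets: "cylinder n y \<in> sets seq_space"
proof -
  have "cylinder n y = {w \<in> space seq_space. \<forall>k\<in>{..<n}. w k = y k}"
    by (auto simp: cylinder_def seq_space_def space_PiM)
  also have "\<dots> \<in> sets seq_space"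
    unfolding seq_space_def by measurable
  finally show ?thesis .
qed

lemma open_in_sets:
  assumes "openin seq_top U"
  shows "U \<in> sets seq_space"
proof -
  have "U = \<Union>{A \<in> {cylinder n y | n y. True}. A \<subseteq> U}"
  proof (intro equalityI subsetI)
    fix y assume "y \<in> U"
    then obtain n where "cylinder n y \<subseteq> U" using assms by (auto simp: openin_seq_top)
    moreover have "y \<in> cylinder n y" by (simp add: cylinder_def)
    ultimately show "y \<in> \<Union>{A \<in> {cylinder n y | n y. True}. A \<subseteq> U}" by blast
  qed auto
  moreover have "\<Union>{A \<in> {cylinder n y | n y. True}. A \<subseteq> U} \<in> sets seq_space"
    by (rule sets.countable_Union) (auto intro: cylinder_in_sets countable_subset[OF _ countable_cylinders])
  ultimately show ?thesis by simp
qed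

lemma space_seq_space: "space seq_space = UNIV"
  by (simp add: seq_space_def space_PiM)

lemma openin_coordinate: "openin seq_top {f. f i \<in> A}"
  unfolding openin_seq_top
  by (intro ballI exI[of _ "Suc i"]) (auto simp: cylinder_def)

lemma sets_seq_space: "sets seq_space = sigma_sets UNIV {U. openin seq_top U}"
proof
  have "sets seq_space = sigma_sets UNIV {{f. f i \<in> A} | i A. True}"
    by (simp add: seq_space_def sets_PiM_single)
  also have "\<dots> \<subseteq> sigma_sets UNIV {U. openin seq_top U}"
    by (rule sigma_sets_mono) (auto intro!: sigma_sets.Basic openin_coordinate)
  finally show "sets seq_space \<subseteq> sigma_sets UNIV {U. openin seq_top U}" .
  show "sigma_sets UNIV {U. openin seq_top U} \<subseteq> sets seq_space"
    using sets.sigma_sets_subset[of "{U. openin seq_top U}" seq_space] open_in_sets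
    by (auto simp: space_seq_space)
qed

lemma sets_plan_space:
  "sets plan_space = sigma_sets UNIV {U. openin (prod_topology (discrete_topology UNIV) seq_top) U}"
    (is "_ = sigma_sets UNIV ?O")
proof
  have op: "openin (prod_topology (discrete_topology UNIV) seq_top) (A \<times> U)"
    if "openin seq_top U" for A :: "2 set" and U
    using that by (simp add: openin_prod_Times_iff)
  have emb: "A \<times> B \<in> sigma_sets UNIV ?O" if "B \<in> sigma_sets UNIV {U. openin seq_top U}" for A :: "2 set" and B
    using that
  proof induction
    case (Basic U)
    then show ?case using op by (intro sigma_sets.Basic) auto
  next
    case Empty
    then show ?case by (simp add: sigma_sets.Empty)
  next
    case (Compl B)
    interpret sigma_algebra UNIV "sigma_sets UNIV ?O" by (rule sigma_algebra_sigma_sets) auto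
    have "openin seq_top UNIV" by (auto simp: openin_seq_top)
    then have "A \<times> UNIV \<in> sigma_sets UNIV ?O" using op by (intro sigma_sets.Basic) auto
    then have "A \<times> UNIV - A \<times> B \<in> sigma_sets UNIV ?O" using Compl by blast
    moreover have "A \<times> UNIV - A \<times> B = A \<times> (UNIV - B)" by auto
    ultimately show ?case by simp
  next
    case (Union B)
    have "A \<times> (\<Union>i. B i) = (\<Union>i. A \<times> B i)" by auto
    then show ?case using Union by (auto intro: sigma_sets.Union)
  qed
  have "sets plan_space = sigma_sets UNIV {A \<times> B | A B. B \<in> sets seq_space}"
    by (simp add: plan_space_def sets_pair_measure space_seq_space)
  also have "\<dots> \<subseteq> sigma_sets UNIV ?O"
    by (rule sigma_sets_mono) (auto simp: sets_seq_space intro: emb)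
  finally show "sets plan_space \<subseteq> sigma_sets UNIV ?O" .
  have "U \<in> sets plan_space" if U: "openin (prod_topology (discrete_topology UNIV) seq_top) U" for U
  proof -
    have slice: "openin seq_top {y. (x, y) \<in> U}" for x
    proof -
      have "continuous_map seq_top (prod_topology (discrete_topology UNIV) seq_top) (\<lambda>y. (x, y))"
        by (simp add: continuous_map_pairedI)
      from openin_continuous_map_preimage[OF this U] show ?thesis
        by (simp add: seq_top_def)
    qed
    have "U = (\<Union>x. {x} \<times> {y. (x, y) \<in> U})" by auto
    also have "\<dots> \<in> sets plan_space"
      unfolding plan_space_def using open_in_sets[OF slice] by (intro sets.finite_UN) auto
    finally show ?thesis .
  qed
  moreover have "space plan_space = UNIV"
    by (simp add: plan_space_def space_pair_measure space_seq_space)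
  ultimately show "sigma_sets UNIV ?O \<subseteq> sets plan_space"
    using sets.sigma_sets_subset[of ?O plan_space] by auto
qed

end

theory Submission
  imports Defs
begin

text \<open>
  Write \<open>A = C\<^sup>1\<close>, \<open>B = C\<^sup>2\<close> and \<open>\<lambda>(M)\<close> for the Perron eigenvalue of a positive matrix \<open>M\<close>.

  The link between pressure and matrices is a variational principle. If \<open>h\<close> is a positive left
  eigenvector of the matrix with entries \<open>\<Sum>\<^sub>x exp (f x i j)\<close> for the eigenvalue \<open>r\<close>, then
  \<open>w x i j = exp (f x i j) h\<^sub>i / (r h\<^sub>j)\<close> has total mass \<open>1\<close> for each \<open>j\<close>, and \<open>f\<close> equals
  \<open>ln w + ln r\<close> up to the coboundary \<open>ln h\<^sub>j - ln h\<^sub>i\<close>, which every invariant plan integrates to \<open>0\<close>.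
  So the pressure of \<open>f\<close> is \<open>ln r\<close> (\<open>pressure_eq_ln_eigenvalue\<close>) by two facts: every invariant
  plan \<open>\<pi>\<close> has entropy at most \<open>- \<integral> ln w d\<pi>\<close> (\<open>gibbs_inequality\<close>), and some Markov plan has Jacobian
  exactly \<open>w\<close> and hence attains this bound (\<open>gibbs_plan_exists\<close>).

  The entropy is defined through a pointwise limit, so the Gibbs inequality needs that limit to exist
  almost everywhere. The reciprocals of the approximating Jacobians form a nonnegative
  supermartingale under \<open>\<pi>\<close>, which converges in \<open>[0, \<infinity>]\<close> by counting upcrossings
  (\<open>supermartingale_converges\<close>); Fatou's lemma gives \<open>\<integral> w / J d\<pi> \<le> 1\<close>, and \<open>ln u \<le> u - 1\<close> finishes.

  For the dual problem, put \<open>s = exp (\<phi>\<^sub>1 - \<phi>\<^sub>2)\<close>. Then \<open>\<phi>\<close> is admissible iff \<open>\<phi>\<^sub>1 = ln \<lambda>(A + s B)\<close>, and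
  the objective becomes \<open>ln \<lambda>(A + s B) - (1 - p) ln s\<close>. For \<open>0 < p < 1\<close> this function of \<open>s > 0\<close>
  tends to infinity at both ends; it is strictly convex in \<open>ln s\<close> (Cauchy-Schwarz applied to eigenvectors), so it has exactly one
  minimizer. With \<open>z\<^sub>1 = 1 / \<lambda>\<close> and \<open>z\<^sub>2 = s / \<lambda>\<close>, the first conic is the characteristic equation
  and the second is the vanishing of the derivative. For stochastic columns \<open>\<lambda>(A + s B) = 1 + s\<close>,
  and the minimizer and the value are explicit.

  The two conics meet in at most four points: no intersection point lies on the axis \<open>z\<^sub>1 = 0\<close>, and
  eliminating along each line \<open>z\<^sub>2 = s z\<^sub>1\<close> gives a nonzero polynomial in \<open>s\<close> of degree at most four,
  except when the second conic contains a line through the origin, which is treated separately (\<open>conics_card_le\<close>).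
\<close>

section \<open>Almost sure convergence of nonnegative supermartingales\<close>

text \<open>
  The state after reading the first \<open>n\<close> terms of \<open>X\<close> in a search for upcrossings of \<open>[\<alpha>, \<beta>]\<close>: the number of
  completed upcrossings, and whether a value below \<open>\<alpha>\<close> has been seen since the last one.
\<close>

primrec crossings :: "real \<Rightarrow> real \<Rightarrow> (nat \<Rightarrow> real) \<Rightarrow> nat \<Rightarrow> nat \<times> bool" where
  "crossings \<alpha> \<beta> X 0 = (0, False)"
| "crossings \<alpha> \<beta> X (Suc n) =
     (case crossings \<alpha> \<beta> X n of (k, h) \<Rightarrow>
        if h then (if X n > \<beta> then (Suc k, False) else (k, True)) else (k, X n < \<alpha>))"

lemma crossings_mono: "m \<le> n \<Longrightarrow> fst (crossings \<alpha> \<beta> X m) \<le> fst (crossings \<alpha> \<beta> X n)"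
  by (rule lift_Suc_mono_le[of "\<lambda>n. fst (crossings \<alpha> \<beta> X n)"]) (auto split: prod.split)

lemma crossings_unbounded:
  assumes lo: "\<And>N. \<exists>n\<ge>N. X n < \<alpha>" and hi: "\<And>N. \<exists>n\<ge>N. \<beta> < X n"
  shows "\<exists>n. K \<le> fst (crossings \<alpha> \<beta> X n)"
proof (induction K)
  case 0
  then show ?case by simp
next
  case (Suc K)
  then obtain n where n: "K \<le> fst (crossings \<alpha> \<beta> X n)" by auto
  have hold: "\<exists>m\<ge>n. K \<le> fst (crossings \<alpha> \<beta> X m) \<and> snd (crossings \<alpha> \<beta> X m)"
  proof -
    obtain m where m: "m \<ge> n" "X m < \<alpha>" using lo by blast
    have K: "K \<le> fst (crossings \<alpha> \<beta> X m)" using n crossings_mono[OF m(1)] le_trans by blast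
    show ?thesis
    proof (cases "snd (crossings \<alpha> \<beta> X m)")
      case True
      then show ?thesis using m K by blast
    next
      case False
      then show ?thesis using m K by (intro exI[of _ "Suc m"]) (auto split: prod.split)
    qed
  qed
  then obtain m where m: "K \<le> fst (crossings \<alpha> \<beta> X m)" "snd (crossings \<alpha> \<beta> X m)" by blast
  obtain l where l: "l \<ge> m" "\<beta> < X l" using hi by blast
  have "\<exists>l. Suc K \<le> fst (crossings \<alpha> \<beta> X l)"
  proof (rule ccontr)
    assume no: "\<not> ?thesis"
    have "K \<le> fst (crossings \<alpha> \<beta> X j) \<and> snd (crossings \<alpha> \<beta> X j)" if "m \<le> j" for j
      using that
    proof (induction j rule: dec_induct)
      case (step j)
      have "\<not> Suc K \<le> fst (crossings \<alpha> \<beta> X (Suc j))" using no by blast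
      then show ?case using step by (auto split: prod.splits if_splits)
    qed (use m in simp)
    from this[OF l(1)] l(2) have "Suc K \<le> fst (crossings \<alpha> \<beta> X (Suc l))"
      by (auto split: prod.splits)
    then show False using no by blast
  qed
  then show ?case .
qed

lemma not_convergent_crosses:
  fixes X :: "nat \<Rightarrow> real"
  assumes "\<not> (\<exists>L::ereal. (\<lambda>n. ereal (X n)) \<longlonglongrightarrow> L)"
  shows "\<exists>\<alpha> \<beta>::rat. \<alpha> < \<beta> \<and> (\<forall>N. \<exists>n\<ge>N. X n < real_of_rat \<alpha>) \<and> (\<forall>N. \<exists>n\<ge>N. real_of_rat \<beta> < X n)"
proof -
  let ?X = "\<lambda>n. ereal (X n)"
  have "liminf ?X \<le> limsup ?X" by (simp add: Liminf_le_Limsup)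
  moreover have "liminf ?X \<noteq> limsup ?X"
    using assms by (metis tendsto_iff_Liminf_eq_Limsup trivial_limit_sequentially)
  ultimately have lt: "liminf ?X < limsup ?X" by simp
  obtain \<beta> where \<beta>: "liminf ?X < real_of_rat \<beta>" "real_of_rat \<beta> < limsup ?X"
    using ereal_dense3[OF lt] by auto
  obtain \<alpha> where \<alpha>: "liminf ?X < real_of_rat \<alpha>" "real_of_rat \<alpha> < ereal (real_of_rat \<beta>)"
    using ereal_dense3[OF \<beta>(1)] by auto
  have "\<exists>n\<ge>N. X n < real_of_rat \<alpha>" for N
  proof (rule ccontr)
    assume "\<not> ?thesis"
    then have "eventually (\<lambda>n. ereal (real_of_rat \<alpha>) \<le> ?X n) sequentially"
      by (auto simp: eventually_sequentially not_less intro!: exI[of _ N])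
    from Liminf_bounded[OF this] \<alpha>(1) show False by simp
  qed
  moreover have "\<exists>n\<ge>N. real_of_rat \<beta> < X n" for N
  proof (rule ccontr)
    assume "\<not> ?thesis"
    then have "eventually (\<lambda>n. ?X n \<le> ereal (real_of_rat \<beta>)) sequentially"
      by (auto simp: eventually_sequentially not_less intro!: exI[of _ N])
    from Limsup_bounded[OF this] \<beta>(2) show False by simp
  qed
  ultimately show ?thesis using \<alpha>(2) by (intro exI[of _ \<alpha>] exI[of _ \<beta>]) (simp add: of_rat_less)
qed

text \<open>
  Doob's convergence theorem. While an upcrossing is in progress one holds a unit of \<open>X\<close>, bought below \<open>\<alpha>\<close>
  and sold above \<open>\<beta>\<close>, with the purchase booked at \<open>\<alpha>\<close> and the sale at \<open>\<beta>\<close>. The wealth \<open>V\<close>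
  has nonpositive mean and is at least \<open>\<beta> - \<alpha>\<close> times the number of upcrossings minus \<open>\<bar>\<alpha>\<bar>\<close>, so almost surely there are finitely many upcrossings of each rational interval.
\<close>

lemma supermartingale_converges:
  fixes X :: "nat \<Rightarrow> 'a \<Rightarrow> real"
  assumes "finite_measure M"
    and int: "\<And>n. integrable M (X n)" and nonneg: "\<And>n x. 0 \<le> X n x"
    and adapted: "\<And>n. X n \<in> borel_measurable (F n)"
    and sub: "\<And>n. subalgebra M (F n)" and filt: "\<And>n. subalgebra (F (Suc n)) (F n)"
    and super: "\<And>n A. A \<in> sets (F n) \<Longrightarrow>
      (\<integral>x. indicator A x * X (Suc n) x \<partial>M) \<le> (\<integral>x. indicator A x * X n x \<partial>M)"
  shows "AE x in M. \<exists>L::ereal. (\<lambda>n. ereal (X n x)) \<longlonglongrightarrow> L"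
proof -
  interpret finite_measure M by fact
  have cross: "AE x in M. \<exists>K. \<forall>n. fst (crossings \<alpha> \<beta> (\<lambda>m. X m x) n) \<le> K"
    if ab: "\<alpha> < \<beta>" for \<alpha> \<beta>
  proof -
    define st where "st n x = crossings \<alpha> \<beta> (\<lambda>m. X m x) n" for n x
    define H where "H n = {x \<in> space M. snd (st n x)}" for n
    \<comment> \<open>\<open>H n\<close> is empty for \<open>n = 0\<close>, so the value of \<open>X (n - 1)\<close> there does not matter\<close>
    define V where "V n x = (\<beta> - \<alpha>) * real (fst (st n x)) + indicator (H n) x * (X (n - 1) x - \<alpha>)" for n x
    have spF: "space (F n) = space M" for n using sub by (simp add: subalgebra_def)
    have F_mono: "subalgebra (F m) (F n)" if "n \<le> m" for n m
      using that
    proof (induction m rule: dec_induct)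
      case (step m)
      then show ?case using filt[of m] by (auto simp: subalgebra_def)
    qed (simp add: subalgebra_def)
    have st_F: "st n \<in> measurable (F m) (count_space UNIV)" if "n \<le> Suc m" for n m
      using that
    proof (induction n)
      case 0
      then show ?case by (simp add: st_def[abs_def])
    next
      case (Suc n)
      have X[measurable]: "X n \<in> borel_measurable (F m)"
        using measurable_from_subalg[OF F_mono adapted] Suc.prems by simp
      define step where "step s x = (case s of (k, h) \<Rightarrow>
        if h then (if X n x > \<beta> then (Suc k, False) else (k, True)) else (k, X n x < \<alpha>))"
        for s :: "nat \<times> bool" and x
      have step: "step s \<in> measurable (F m) (count_space UNIV)" for s
      proof (cases s)
        case (Pair k h)
        have "(\<lambda>x. X n x < \<alpha>) \<in> measurable (F m) (count_space UNIV)" by measurable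
        then have "(\<lambda>x. (k, X n x < \<alpha>)) \<in> measurable (F m) (count_space UNIV)"
          by (rule measurable_compose) simp
        moreover have "(\<lambda>x. if X n x > \<beta> then (Suc k, False) else (k, True)) \<in> measurable (F m) (count_space UNIV)"
          by measurable
        ultimately show ?thesis by (cases h) (simp_all add: Pair step_def[abs_def])
      qed
      have "(\<lambda>x. step (st n x) x) \<in> measurable (F m) (count_space UNIV)"
        by (rule measurable_compose_countable[OF step Suc.IH]) (use Suc.prems in simp)
      then show ?case by (simp add: st_def[abs_def] step_def)
    qed
    have st_M[measurable]: "st n \<in> measurable M (count_space UNIV)" for n
      using st_F[of n n] measurable_from_subalg[OF sub] by auto
    have H_F: "H (Suc n) \<in> sets (F n)" for n
    proof -
      have "st (Suc n) -` {s. snd s} \<inter> space (F n) \<in> sets (F n)"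
        using st_F[of "Suc n" n] by (rule measurable_sets) auto
      moreover have "st (Suc n) -` {s. snd s} \<inter> space (F n) = H (Suc n)"
        by (auto simp: H_def spF)
      ultimately show ?thesis by simp
    qed
    have H_M[measurable]: "H n \<in> sets M" for n
    proof -
      have "st n -` {s. snd s} \<inter> space M \<in> sets M"
        using st_M by (rule measurable_sets) auto
      moreover have "st n -` {s. snd s} \<inter> space M = H n"
        by (auto simp: H_def)
      ultimately show ?thesis by simp
    qed
    have X_M[measurable]: "X n \<in> borel_measurable M" for n using int by auto
    have le: "fst (st n x) \<le> n" for n x
      unfolding st_def by (induction n) (auto split: prod.split)
    have int_k: "integrable M (\<lambda>x. real (fst (st n x)))" for n
      by (rule integrable_const_bound[of _ "real n"]) (use le in auto)
    have int_H: "integrable M (\<lambda>x. indicator (H m) x * (X n x - r))" for m n r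
      using int[of n] by (intro integrable_real_mult_indicator[OF H_M, of "\<lambda>x. X n x - r", simplified mult.commute]) auto
    have int_V: "integrable M (V n)" for n
      unfolding V_def[abs_def] using int_k int_H by auto
    have V_le: "(\<integral>x. V n x \<partial>M) \<le> 0" for n
    proof (induction n)
      case 0
      then show ?case by (simp add: V_def H_def st_def)
    next
      case (Suc n)
      have step: "V (Suc n) x \<le> V n x + indicator (H n) x * (X n x - X (n - 1) x)" if "x \<in> space M" for x
        using that ab unfolding V_def H_def
        by (auto simp: st_def algebra_simps indicator_def split: prod.splits)
      have int_D: "integrable M (\<lambda>x. indicator (H n) x * (X n x - X (n - 1) x))"
        using int_H[of n n 0] int_H[of n "n-1" 0] by (simp add: right_diff_distrib)
      have "(\<integral>x. V (Suc n) x \<partial>M) \<le> (\<integral>x. V n x + indicator (H n) x * (X n x - X (n - 1) x) \<partial>M)"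
        by (rule integral_mono) (use step int_V int_D in auto)
      also have "\<dots> = (\<integral>x. V n x \<partial>M) + (\<integral>x. indicator (H n) x * (X n x - X (n - 1) x) \<partial>M)"
        using int_V int_D by simp
      also have "(\<integral>x. indicator (H n) x * (X n x - X (n - 1) x) \<partial>M) \<le> 0"
      proof (cases n)
        case 0
        then show ?thesis by (simp add: H_def st_def)
      next
        case (Suc m)
        then show ?thesis using super[OF H_F[of m]] int_H[of n n 0] int_H[of n "n-1" 0]
          by (simp add: right_diff_distrib)
      qed
      finally show ?case using Suc by simp
    qed
    define B where "B = \<bar>\<alpha>\<bar> * measure M (space M) / (\<beta> - \<alpha>)"
    have k_le: "(\<integral>x. real (fst (st n x)) \<partial>M) \<le> B" for n
    proof -
      have "(\<beta> - \<alpha>) * real (fst (st n x)) - \<bar>\<alpha>\<bar> \<le> V n x" for x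
        using nonneg[of "n - 1" x] abs_ge_self[of \<alpha>] by (auto simp: V_def indicator_def)
      then have "(\<integral>x. (\<beta> - \<alpha>) * real (fst (st n x)) - \<bar>\<alpha>\<bar> \<partial>M) \<le> (\<integral>x. V n x \<partial>M)"
        using int_k int_V by (intro integral_mono) simp_all
      then have "(\<integral>x. (\<beta> - \<alpha>) * real (fst (st n x)) - \<bar>\<alpha>\<bar> \<partial>M) \<le> 0" using V_le[of n] by simp
      then show ?thesis using int_k[of n] ab by (simp add: B_def field_simps)
    qed
    have "(\<integral>\<^sup>+x. (SUP n. ennreal (real (fst (st n x)))) \<partial>M) = (SUP n. \<integral>\<^sup>+x. ennreal (real (fst (st n x))) \<partial>M)"
    proof (rule nn_integral_monotone_convergence_SUP)
      show "incseq (\<lambda>n x. ennreal (real (fst (st n x))))"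
        by (auto simp: incseq_def le_fun_def st_def crossings_mono)
      show "(\<lambda>x. ennreal (real (fst (st n x)))) \<in> borel_measurable M" for n
        using int_k[of n] by simp
    qed
    also have "\<dots> \<le> ennreal B"
      by (rule SUP_least) (use k_le int_k in \<open>auto simp: nn_integral_eq_integral intro!: ennreal_leI\<close>)
    finally have "(\<integral>\<^sup>+x. (SUP n. ennreal (real (fst (st n x)))) \<partial>M) \<noteq> \<infinity>"
      by (auto simp: top_unique)
    then have "AE x in M. (SUP n. ennreal (real (fst (st n x)))) \<noteq> \<infinity>"
      by (intro nn_integral_PInf_AE) auto
    then show ?thesis
    proof eventually_elim
      case (elim x)
      then obtain r where r: "0 \<le> r" "(SUP n. ennreal (real (fst (st n x)))) = ennreal r"
        by (metis ennreal_cases infinity_ennreal_def)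
      have "real (fst (st n x)) \<le> r" for n
        using r SUP_upper[of n UNIV "\<lambda>n. ennreal (real (fst (st n x)))"] by simp
      then have "fst (st n x) \<le> nat \<lfloor>r\<rfloor>" for n by (rule le_nat_floor)
      then show ?case unfolding st_def by blast
    qed
  qed
  have "AE x in M. \<forall>\<alpha> \<beta>::rat. \<alpha> < \<beta> \<longrightarrow>
      (\<exists>K. \<forall>n. fst (crossings (real_of_rat \<alpha>) (real_of_rat \<beta>) (\<lambda>m. X m x) n) \<le> K)"
    unfolding AE_all_countable by (auto intro!: AE_impI cross simp: of_rat_less)
  then show ?thesis
  proof eventually_elim
    case (elim x)
    show ?case
    proof (rule ccontr)
      assume "\<not> ?case"
      then obtain \<alpha> \<beta> :: rat where ab: "\<alpha> < \<beta>" "\<And>N. \<exists>n\<ge>N. X n x < real_of_rat \<alpha>" "\<And>N. \<exists>n\<ge>N. real_of_rat \<beta> < X n x"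
        using not_convergent_crosses[of "\<lambda>n. X n x"] by blast
      with elim obtain K where "\<And>n. fst (crossings (real_of_rat \<alpha>) (real_of_rat \<beta>) (\<lambda>m. X m x) n) \<le> K" by blast
      moreover obtain n where "Suc K \<le> fst (crossings (real_of_rat \<alpha>) (real_of_rat \<beta>) (\<lambda>m. X m x) n)"
        using crossings_unbounded[OF ab(2,3), of "Suc K"] by blast
      ultimately show False by (metis not_less_eq_eq)
    qed
  qed
qed

section \<open>Functions of finitely many coordinates\<close>

text \<open>
  All coordinates of the sequence from position \<open>n\<close> on are reset to \<open>1\<close>. A function \<open>g\<close> with
  \<open>g (truncation n z) = g z\<close> is one that depends only on the symbol and the first \<open>n\<close> coordinates.
\<close>

definition truncation :: "nat \<Rightarrow> 2 \<times> seq \<Rightarrow> 2 \<times> seq" where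
  "truncation n z = (fst z, \<lambda>k. if k < n then snd z k else 1)"

text \<open>
  The cylinder of length \<open>n\<close> around \<open>z\<close> in the product of the symbols and the sequences.
\<close>

definition block :: "nat \<Rightarrow> 2 \<times> seq \<Rightarrow> (2 \<times> seq) set" where
  "block n z = {fst z} \<times> cylinder n (snd z)"

text \<open>
  Integration against the measure of total mass \<open>4\<close> that puts counting measure on the symbol and on the
  first coordinate, and \<open>\<nu>\<close> on the shifted sequence. The Jacobian of an invariant plan is
  its density with respect to this measure, taken for its own marginal \<open>\<nu>\<close>.
\<close>

definition lift_integral :: "seq measure \<Rightarrow> (2 \<times> seq \<Rightarrow> real) \<Rightarrow> real" where
  "lift_integral \<nu> g = (\<Sum>x\<in>UNIV. \<Sum>a\<in>UNIV. \<integral>y. g (x, case_nat a y) \<partial>\<nu>)"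

lemma finite_range_truncation: "finite (range (truncation n))"
proof -
  have "range (truncation n) \<subseteq> UNIV \<times> (\<lambda>f k. if k < n then f k else 1) ` (Pi\<^sub>E {..<n} (\<lambda>_. UNIV))"
  proof
    fix z assume "z \<in> range (truncation n)"
    then obtain u where z: "z = truncation n u" by auto
    have "snd z = (\<lambda>k. if k < n then restrict (snd u) {..<n} k else 1)"
      unfolding z truncation_def by auto
    then have "snd z \<in> (\<lambda>f k. if k < n then f k else 1) ` (Pi\<^sub>E {..<n} (\<lambda>_. UNIV))"
      by (rule image_eqI[where x = "restrict (snd u) {..<n}"]) auto
    then show "z \<in> UNIV \<times> (\<lambda>f k. if k < n then f k else 1) ` (Pi\<^sub>E {..<n} (\<lambda>_. UNIV))"
      by (cases z) auto
  qed
  moreover have "finite (UNIV \<times> (\<lambda>f k. if k < n then f k else 1) ` (Pi\<^sub>E {..<n} (\<lambda>_. UNIV :: 2 set)) :: (2 \<times> seq) set)"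
    by (intro finite_cartesian_product finite_imageI finite_PiE) auto
  ultimately show ?thesis by (rule finite_subset)
qed

lemma truncation_eq_iff: "truncation n u = truncation n z \<longleftrightarrow> u \<in> block n z"
  by (cases u; cases z) (auto simp: truncation_def block_def cylinder_def fun_eq_iff)

lemma block_truncation: "block n (truncation n z) = block n z"
  by (auto simp: truncation_def block_def cylinder_def)

lemma truncation_truncation: "m \<le> n \<Longrightarrow> truncation m (truncation n z) = truncation m z"
  by (auto simp: truncation_def)

lemma in_block_iff: "z \<in> range (truncation n) \<Longrightarrow> u \<in> block n z \<longleftrightarrow> truncation n u = z"
  using truncation_eq_iff[of n u z] truncation_truncation[of n n] by auto

lemma block_in_sets: "block n z \<in> sets plan_space"
  unfolding block_def plan_space_def by (intro pair_measureI cylinder_in_sets) auto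

lemma space_plan_space: "space plan_space = UNIV"
  by (simp add: plan_space_def space_pair_measure space_seq_space)

lemma truncation_function_eq_sum:
  fixes g :: "2 \<times> seq \<Rightarrow> real"
  assumes "\<And>z. g (truncation n z) = g z"
  shows "g u = (\<Sum>z\<in>range (truncation n). g z * indicator (block n z) u)"
proof -
  have "(\<Sum>z\<in>range (truncation n). g z * indicator (block n z) u) = (\<Sum>z\<in>{truncation n u}. g z * indicator (block n z) u)"
  proof (rule sum.mono_neutral_right)
    show "\<forall>z\<in>range (truncation n) - {truncation n u}. g z * indicator (block n z) u = 0"
    proof
      fix z assume z: "z \<in> range (truncation n) - {truncation n u}"
      then have "u \<notin> block n z" using in_block_iff[of z n u] by auto
      then show "g z * indicator (block n z) u = 0" by simp
    qed
  qed (auto simp: finite_range_truncation)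
  also have "\<dots> = g u" using assms by (simp add: block_truncation truncation_eq_iff[symmetric])
  finally show ?thesis ..
qed

lemma truncation_function_measurable:
  fixes g :: "2 \<times> seq \<Rightarrow> real"
  assumes "\<And>z. g (truncation n z) = g z"
  shows "g \<in> borel_measurable plan_space"
proof -
  have "(\<lambda>u. \<Sum>z\<in>range (truncation n). g z * indicator (block n z) u) \<in> borel_measurable plan_space"
    by (intro borel_measurable_sum borel_measurable_times borel_measurable_indicator block_in_sets) auto
  then show ?thesis by (subst ext[OF truncation_function_eq_sum[where g = g and n = n, OF assms]])
qed

lemma truncation_measurable: "truncation n \<in> measurable plan_space (count_space UNIV)"
proof (rule measurableI)
  fix B :: "(2 \<times> seq) set"
  have "truncation n -` B \<inter> space plan_space = (\<Union>z\<in>range (truncation n) \<inter> B. block n z)"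
    by (auto simp: space_plan_space in_block_iff) (metis rangeI)
  then show "truncation n -` B \<inter> space plan_space \<in> sets plan_space"
    using finite_range_truncation[of n] by (auto intro!: sets.finite_UN block_in_sets)
qed auto

lemma integral_truncation_function:
  fixes g :: "2 \<times> seq \<Rightarrow> real"
  assumes fin: "finite_measure \<pi>" and sets: "sets \<pi> = sets plan_space" and g: "\<And>z. g (truncation n z) = g z"
  shows "integrable \<pi> g" "(\<integral>z. g z \<partial>\<pi>) = (\<Sum>z\<in>range (truncation n). g z * measure \<pi> (block n z))"
proof -
  interpret finite_measure \<pi> by fact
  have gs: "g = (\<lambda>u. \<Sum>z\<in>range (truncation n). g z * indicator (block n z) u)"
    by (rule ext) (rule truncation_function_eq_sum[where g = g and n = n, OF g])
  have [simp]: "block n z \<in> sets \<pi>" "block n z \<inter> space \<pi> = block n z" for z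
    using block_in_sets sets sets_eq_imp_space_eq[OF sets] by (auto simp: space_plan_space)
  have int: "integrable \<pi> (\<lambda>u. g z * indicator (block n z) u)" for z
    by (intro integrable_mult_right integrable_real_indicator) (auto simp: emeasure_eq_measure)
  show "integrable \<pi> g" by (subst gs) (intro Bochner_Integration.integrable_sum int)
  show "(\<integral>z. g z \<partial>\<pi>) = (\<Sum>z\<in>range (truncation n). g z * measure \<pi> (block n z))"
    by (subst gs) (simp add: Bochner_Integration.integral_sum[OF int])
qed

lemma lift_integral_truncation_function:
  fixes g :: "2 \<times> seq \<Rightarrow> real"
  assumes fin: "finite_measure \<nu>" and sets: "sets \<nu> = sets seq_space" and g: "\<And>z. g (truncation (Suc m) z) = g z"
  shows "integrable \<nu> (\<lambda>y. g (x, case_nat a y))"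
    "lift_integral \<nu> g = (\<Sum>z\<in>range (truncation (Suc m)). g z * measure \<nu> (cylinder m (shift (snd z))))"
proof -
  interpret finite_measure \<nu> by fact
  have sp: "space \<nu> = UNIV" using sets_eq_imp_space_eq[OF sets] by (simp add: space_seq_space)
  have gs: "g u = (\<Sum>z\<in>range (truncation (Suc m)). g z * indicator (block (Suc m) z) u)" for u
    by (rule truncation_function_eq_sum[where g = g and n = "Suc m", OF g])
  have ind: "indicator (block (Suc m) z) (x, case_nat a y) =
      (if x = fst z \<and> a = snd z 0 then indicator (cylinder m (shift (snd z))) y else (0::real))" for x a y z
    by (auto simp: block_def cylinder_def shift_def indicator_def All_less_Suc2)
  have [simp]: "cylinder n y \<in> sets \<nu>" for n y using cylinder_in_sets sets by simp
  have int: "integrable \<nu> (\<lambda>y. g z * indicator (block (Suc m) z) (x, case_nat a y))" for z x a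
    unfolding ind by (cases "x = fst z \<and> a = snd z 0") (auto intro!: integrable_mult_right simp: emeasure_eq_measure)
  show "integrable \<nu> (\<lambda>y. g (x, case_nat a y))" by (subst gs) (intro Bochner_Integration.integrable_sum int)
  have one: "(\<integral>y. indicator (block (Suc m) z) (x, case_nat a y) \<partial>\<nu>) =
      (if a = snd z 0 then if x = fst z then measure \<nu> (cylinder m (shift (snd z))) else 0 else 0)" for z x a
    unfolding ind by (simp add: sp)
  have "lift_integral \<nu> g = (\<Sum>x\<in>UNIV. \<Sum>a\<in>UNIV. \<Sum>z\<in>range (truncation (Suc m)).
      g z * (\<integral>y. indicator (block (Suc m) z) (x, case_nat a y) \<partial>\<nu>))"
    unfolding lift_integral_def by (subst gs) (simp add: Bochner_Integration.integral_sum[OF int])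
  also have "\<dots> = (\<Sum>z\<in>range (truncation (Suc m)). \<Sum>x\<in>UNIV. \<Sum>a\<in>UNIV.
      g z * (\<integral>y. indicator (block (Suc m) z) (x, case_nat a y) \<partial>\<nu>))"
    by (subst sum.swap, subst (2) sum.swap) (simp add: sum.swap[of _ UNIV "range (truncation (Suc m))"])
  also have "\<dots> = (\<Sum>z\<in>range (truncation (Suc m)). g z * measure \<nu> (cylinder m (shift (snd z))))"
    unfolding one sum_distrib_left[symmetric] by simp
  finally show "lift_integral \<nu> g = (\<Sum>z\<in>range (truncation (Suc m)). g z * measure \<nu> (cylinder m (shift (snd z))))" .
qed

section \<open>Convergence of the Jacobians of an invariant plan\<close>

lemma invariant_plansD:
  assumes "\<pi> \<in> invariant_plans"
  shows "prob_space \<pi>" "sets \<pi> = sets plan_space" "distr (marginal_seq \<pi>) seq_space shift = marginal_seq \<pi>"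
  using assms by (auto simp: invariant_plans_def plans_def)

lemma snd_measurable: "snd \<in> measurable plan_space seq_space"
  unfolding plan_space_def by measurable

lemma shift_measurable: "shift \<in> measurable seq_space seq_space"
proof -
  have "(\<lambda>y. y (Suc k)) \<in> measurable seq_space (count_space UNIV)" for k
    unfolding seq_space_def by measurable
  then show ?thesis
    by (subst (2) seq_space_def, intro measurable_PiM_single') (auto simp: space_seq_space space_PiM shift_def)
qed

lemma sets_marginal_seq [simp]: "sets (marginal_seq \<pi>) = sets seq_space"
  by (simp add: marginal_seq_def)

lemma space_marginal_seq [simp]: "space (marginal_seq \<pi>) = UNIV"
  by (simp add: marginal_seq_def space_seq_space)

lemma cylinder_shift_truncation: "cylinder m (shift (snd (truncation (Suc m) z))) = cylinder m (shift (snd z))"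
  by (auto simp: truncation_def cylinder_def shift_def)

text \<open>
  The reciprocal of \<^const>\<open>jac_approx\<close> of order \<open>m + 1\<close> at points whose shifted sequence lies in the
  support; it is \<open>0\<close> on blocks of mass \<open>0\<close>, which form a null set.
\<close>

definition likelihood_ratio :: "(2 \<times> seq) measure \<Rightarrow> nat \<Rightarrow> 2 \<times> seq \<Rightarrow> real" where
  "likelihood_ratio \<pi> m z =
     measure (marginal_seq \<pi>) (cylinder m (shift (snd z))) / measure \<pi> (block (Suc m) z)"

lemma truncation_function_mono:
  assumes "\<And>z. g (truncation m z) = g z" "m \<le> n"
  shows "g (truncation n z) = g z"
  using assms(1)[of "truncation n z"] assms(1)[of z] truncation_truncation[OF assms(2), of z] by simp

lemma block_Suc_subset: "block (Suc n) z \<subseteq> block n z"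
  by (auto simp: block_def cylinder_def)

context
  fixes \<pi> assumes inv: "\<pi> \<in> invariant_plans"
begin

interpretation prob_space \<pi> by (rule invariant_plansD[OF inv])

lemma sets_plan: "sets \<pi> = sets plan_space" by (rule invariant_plansD[OF inv])

lemma space_plan: "space \<pi> = UNIV"
  using sets_eq_imp_space_eq[OF sets_plan] by (simp add: space_plan_space)

lemma snd_measurable_plan: "snd \<in> measurable \<pi> seq_space"
  using snd_measurable measurable_cong_sets[OF sets_plan refl] by blast

lemma prob_space_marginal_seq: "prob_space (marginal_seq \<pi>)"
  unfolding marginal_seq_def by (rule prob_space_distr[OF snd_measurable_plan])

lemma block_in_events [simp]: "block n z \<in> sets \<pi>"
  by (simp add: sets_plan block_in_sets)

lemma measure_shift_cylinder: 
  "measure (marginal_seq \<pi>) (cylinder n y) = measure \<pi> {z. shift (snd z) \<in> cylinder n y}"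
proof -
  have "measure (marginal_seq \<pi>) (cylinder n y) = measure (distr (marginal_seq \<pi>) seq_space shift) (cylinder n y)"
    by (simp add: invariant_plansD(3)[OF inv])
  also have "\<dots> = measure (marginal_seq \<pi>) (shift -` cylinder n y)"
    using measurable_cong_sets[OF sets_marginal_seq refl] shift_measurable
    by (subst measure_distr) (auto simp: cylinder_in_sets)
  also have "\<dots> = measure \<pi> {z. shift (snd z) \<in> cylinder n y}"
    unfolding marginal_seq_def
    using snd_measurable_plan measurable_sets[OF shift_measurable cylinder_in_sets]
    by (subst measure_distr) (auto simp: space_seq_space space_plan vimage_def)
  finally show ?thesis .
qed

lemma measure_block_le: "measure \<pi> (block (Suc n) z) \<le> measure (marginal_seq \<pi>) (cylinder n (shift (snd z)))"
proof -
  have "{z'. shift (snd z') \<in> cylinder n (shift (snd z))} \<in> sets \<pi>"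
    using measurable_sets[OF measurable_comp[OF snd_measurable_plan shift_measurable] cylinder_in_sets, of n "shift (snd z)"]
    by (simp add: space_plan vimage_def)
  then show ?thesis unfolding measure_shift_cylinder
    by (intro finite_measure_mono) (auto simp: block_def cylinder_def shift_def)
qed

lemma likelihood_ratio_truncation: "likelihood_ratio \<pi> m (truncation (Suc m) z) = likelihood_ratio \<pi> m z"
  by (simp add: likelihood_ratio_def block_truncation cylinder_shift_truncation)

lemma likelihood_ratio_nonneg: "0 \<le> likelihood_ratio \<pi> m z"
  by (simp add: likelihood_ratio_def)

text \<open>
  Under \<open>\<pi>\<close> the likelihood ratio acts as the density of the lifted measure, restricted to the blocks that
  \<open>\<pi>\<close> charges. As these sets decrease with \<open>m\<close>, the likelihood ratios form a supermartingale.
\<close>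

lemma integral_likelihood_ratio:
  assumes g: "\<And>z. g (truncation (Suc m) z) = g z"
  shows "integrable \<pi> (\<lambda>z. g z * likelihood_ratio \<pi> m z)"
    "(\<integral>z. g z * likelihood_ratio \<pi> m z \<partial>\<pi>) = lift_integral (marginal_seq \<pi>) (\<lambda>z. g z * indicator {z. 0 < measure \<pi> (block (Suc m) z)} z)"
proof -
  interpret \<nu>: prob_space "marginal_seq \<pi>" by (rule prob_space_marginal_seq)
  have g': "g (truncation (Suc m) z) * likelihood_ratio \<pi> m (truncation (Suc m) z) = g z * likelihood_ratio \<pi> m z" for z
    by (simp add: g likelihood_ratio_truncation)
  show "integrable \<pi> (\<lambda>z. g z * likelihood_ratio \<pi> m z)"
    by (rule integral_truncation_function[where n = "Suc m", OF finite_measure_axioms sets_plan]) (rule g')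
  have "(\<integral>z. g z * likelihood_ratio \<pi> m z \<partial>\<pi>) =
     (\<Sum>z\<in>range (truncation (Suc m)). g z * likelihood_ratio \<pi> m z * measure \<pi> (block (Suc m) z))"
    by (rule integral_truncation_function[where n = "Suc m", OF finite_measure_axioms sets_plan]) (rule g')
  also have "\<dots> = (\<Sum>z\<in>range (truncation (Suc m)). g z * indicator {z. 0 < measure \<pi> (block (Suc m) z)} z * measure (marginal_seq \<pi>) (cylinder m (shift (snd z))))"
    by (intro sum.cong) (auto simp: likelihood_ratio_def zero_less_measure_iff)
  also have "\<dots> = lift_integral (marginal_seq \<pi>) (\<lambda>z. g z * indicator {z. 0 < measure \<pi> (block (Suc m) z)} z)"
    by (rule lift_integral_truncation_function(2)[OF \<nu>.finite_measure_axioms, symmetric]) (simp_all add: g block_truncation indicator_def)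
  finally show "(\<integral>z. g z * likelihood_ratio \<pi> m z \<partial>\<pi>) = lift_integral (marginal_seq \<pi>) (\<lambda>z. g z * indicator {z. 0 < measure \<pi> (block (Suc m) z)} z)" .
qed

lemma lift_integral_mono:
  assumes "\<And>z. f (truncation (Suc m) z) = f z" "\<And>z. g (truncation (Suc n) z) = g z" "\<And>z. f z \<le> g z"
  shows "lift_integral (marginal_seq \<pi>) f \<le> lift_integral (marginal_seq \<pi>) g"
proof -
  interpret \<nu>: prob_space "marginal_seq \<pi>" by (rule prob_space_marginal_seq)
  show ?thesis unfolding lift_integral_def
    using assms by (intro sum_mono integral_mono lift_integral_truncation_function(1)[OF \<nu>.finite_measure_axioms]) auto
qed

lemma likelihood_ratio_converges: "AE z in \<pi>. \<exists>L::ereal. (\<lambda>n. ereal (likelihood_ratio \<pi> n z)) \<longlonglongrightarrow> L"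
proof (rule supermartingale_converges[where F = "\<lambda>n. vimage_algebra UNIV (truncation (Suc n)) (count_space UNIV)"])
  show "finite_measure \<pi>" by (rule finite_measure_axioms)
  show "integrable \<pi> (likelihood_ratio \<pi> n)" for n
    using integral_likelihood_ratio(1)[of "\<lambda>_. 1"] by simp
  show "0 \<le> likelihood_ratio \<pi> n x" for n x by (rule likelihood_ratio_nonneg)
  have F: "sets (vimage_algebra UNIV (truncation n) (count_space UNIV)) = {truncation n -` B |B. True}" for n
    by (simp add: sets_vimage_algebra2)
  show "likelihood_ratio \<pi> n \<in> borel_measurable (vimage_algebra UNIV (truncation (Suc n)) (count_space UNIV))" for n
  proof -
    have "(\<lambda>z. likelihood_ratio \<pi> n (truncation (Suc n) z)) \<in> borel_measurable (vimage_algebra UNIV (truncation (Suc n)) (count_space UNIV))"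
      by (rule measurable_compose[OF measurable_vimage_algebra1]) auto
    then show ?thesis by (simp add: likelihood_ratio_truncation)
  qed
  show "subalgebra \<pi> (vimage_algebra UNIV (truncation (Suc n)) (count_space UNIV))" for n
    using measurable_sets[OF truncation_measurable, of _ "Suc n"]
    by (auto simp: subalgebra_def F space_plan sets_plan space_plan_space)
  show "subalgebra (vimage_algebra UNIV (truncation (Suc (Suc n))) (count_space UNIV)) (vimage_algebra UNIV (truncation (Suc n)) (count_space UNIV))" for n
  proof -
    have "\<exists>B'. truncation (Suc n) -` B = truncation (Suc (Suc n)) -` B'" for B
      by (rule exI[of _ "truncation (Suc n) -` B"]) (simp add: vimage_def truncation_truncation)
    then show ?thesis by (auto simp: subalgebra_def F)
  qed
  fix n A assume "A \<in> sets (vimage_algebra UNIV (truncation (Suc n)) (count_space UNIV))"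
  then obtain B where A: "A = truncation (Suc n) -` B" by (auto simp: F)
  have ind: "indicator A (truncation (Suc n) z) = (indicator A z :: real)"
    "indicator A (truncation (Suc (Suc n)) z) = (indicator A z :: real)" for z
    by (simp_all add: A indicator_def truncation_truncation)
  have pos: "0 < measure \<pi> (block (Suc n) z)" if "0 < measure \<pi> (block (Suc (Suc n)) z)" for z
    using that finite_measure_mono[OF block_Suc_subset[of "Suc n" z]] by simp
  have "(\<integral>z. indicator A z * likelihood_ratio \<pi> (Suc n) z \<partial>\<pi>)
      = lift_integral (marginal_seq \<pi>) (\<lambda>z. indicator A z * indicator {z. 0 < measure \<pi> (block (Suc (Suc n)) z)} z)"
    by (rule integral_likelihood_ratio(2)) (rule ind)
  also have "\<dots> \<le> lift_integral (marginal_seq \<pi>) (\<lambda>z. indicator A z * indicator {z. 0 < measure \<pi> (block (Suc n) z)} z)"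
    by (rule lift_integral_mono[of _ "Suc n" _ n])
       (auto simp: ind block_truncation pos simp flip: indicator_inter_arith split: split_indicator)
  also have "\<dots> = (\<integral>z. indicator A z * likelihood_ratio \<pi> n z \<partial>\<pi>)"
    by (rule integral_likelihood_ratio(2)[symmetric]) (rule ind)
  finally show "(\<integral>z. indicator A z * likelihood_ratio \<pi> (Suc n) z \<partial>\<pi>) \<le> (\<integral>z. indicator A z * likelihood_ratio \<pi> n z \<partial>\<pi>)" .
qed

end

section \<open>The Gibbs inequality for the entropy\<close>

context
  fixes \<pi> assumes inv: "\<pi> \<in> invariant_plans"
begin

interpretation prob_space \<pi> by (rule invariant_plansD[OF inv])

interpretation \<nu>: prob_space "marginal_seq \<pi>" by (rule prob_space_marginal_seq[OF inv])

lemma AE_block_pos: "AE z in \<pi>. \<forall>n. 0 < measure \<pi> (block n z)"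
  unfolding AE_all_countable
proof
  fix n
  define g :: "2 \<times> seq \<Rightarrow> real" where "g = indicator {z. measure \<pi> (block n z) = 0}"
  have g: "g (truncation n z) = g z" for z by (simp add: g_def block_truncation indicator_def)
  note G = integral_truncation_function[where n = n and g = g, OF finite_measure_axioms sets_plan[OF inv]]
  have "(\<Sum>z\<in>range (truncation n). g z * measure \<pi> (block n z)) = 0"
    by (intro sum.neutral) (auto simp: g_def indicator_def)
  then have "(\<integral>z. g z \<partial>\<pi>) = 0" using G(2)[OF g] by simp
  then have "AE z in \<pi>. g z = 0"
    using G(1)[OF g] by (subst (asm) integral_nonneg_eq_0_iff_AE) (auto simp: g_def)
  then show "AE z in \<pi>. 0 < measure \<pi> (block n z)"
    by eventually_elim (auto simp: g_def indicator_def zero_less_measure_iff split: if_splits)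
qed

lemma seq_support_iff: "y \<in> seq_support (marginal_seq \<pi>) \<longleftrightarrow> (\<forall>n. 0 < measure (marginal_seq \<pi>) (cylinder n y))"
proof
  assume y: "y \<in> seq_support (marginal_seq \<pi>)"
  have "openin seq_top (cylinder n y)" for n
    unfolding openin_seq_top by (auto intro!: exI[of _ n] simp: cylinder_def)
  then show "\<forall>n. 0 < measure (marginal_seq \<pi>) (cylinder n y)"
    using y by (auto simp: seq_support_def cylinder_def)
next
  assume pos: "\<forall>n. 0 < measure (marginal_seq \<pi>) (cylinder n y)"
  show "y \<in> seq_support (marginal_seq \<pi>)"
    unfolding seq_support_def
  proof (intro CollectI allI impI)
    fix U assume U: "openin seq_top U \<and> y \<in> U"
    then obtain n where "cylinder n y \<subseteq> U" by (auto simp: openin_seq_top)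
    then have "measure (marginal_seq \<pi>) (cylinder n y) \<le> measure (marginal_seq \<pi>) U"
      using U by (intro \<nu>.finite_measure_mono) (auto simp: open_in_sets)
    then show "0 < measure (marginal_seq \<pi>) U" using pos by (meson less_le_trans)
  qed
qed

lemma jac_approx_eq:
  "jac_approx \<pi> n z = (if \<forall>m. 0 < measure (marginal_seq \<pi>) (cylinder m (shift (snd z)))
     then measure \<pi> (block n z) / measure (marginal_seq \<pi>) (cylinder (n - 1) (shift (snd z))) else 0)"
  by (cases z) (simp add: jac_approx_def seq_support_iff block_def)

lemma jac_measurable: "jac \<pi> \<in> borel_measurable \<pi>"
proof -
  have 1: "(\<lambda>z. measure (marginal_seq \<pi>) (cylinder m (shift (snd z)))) \<in> borel_measurable plan_space" for m
    by (rule truncation_function_measurable[of _ "Suc m"]) (simp add: cylinder_shift_truncation)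
  have 2: "(\<lambda>z. measure \<pi> (block n z)) \<in> borel_measurable plan_space" for n
    by (rule truncation_function_measurable[of _ n]) (simp add: block_truncation)
  have "{z \<in> space plan_space. \<forall>m. 0 < measure (marginal_seq \<pi>) (cylinder m (shift (snd z)))} \<in> sets plan_space"
    by (intro sets.sets_Collect_countable_All borel_measurable_less 1) simp
  then have "jac_approx \<pi> n \<in> borel_measurable plan_space" for n
    unfolding jac_approx_eq[abs_def]
    by (intro measurable_If borel_measurable_divide 1 2) auto
  then have "(\<lambda>z. lim (\<lambda>n. jac_approx \<pi> n z)) \<in> borel_measurable plan_space"
    by (intro borel_measurable_lim_metric)
  then show ?thesis
    unfolding jac_def[abs_def] using measurable_cong_sets[OF sets_plan[OF inv] refl] by blast
qed

lemma jac_eq_inverse_limit: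
  assumes pos: "\<And>n. 0 < measure \<pi> (block n z)" and l: "(\<lambda>n. likelihood_ratio \<pi> n z) \<longlonglongrightarrow> l"
  shows "1 \<le> l" "jac \<pi> z = 1 / l"
proof -
  have ge1: "1 \<le> likelihood_ratio \<pi> n z" for n
    using measure_block_le[OF inv, of n z] pos by (simp add: likelihood_ratio_def)
  then show l1: "1 \<le> l" by (intro LIMSEQ_le_const[OF l]) auto
  have \<nu>: "0 < measure (marginal_seq \<pi>) (cylinder m (shift (snd z)))" for m
    using measure_block_le[OF inv, of m z] pos[of "Suc m"] by linarith
  have "jac_approx \<pi> (Suc n) z = 1 / likelihood_ratio \<pi> n z" for n
    using \<nu> by (simp add: jac_approx_eq likelihood_ratio_def)
  moreover have "(\<lambda>n. 1 / likelihood_ratio \<pi> n z) \<longlonglongrightarrow> 1 / l"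
    using l l1 by (intro tendsto_intros) auto
  ultimately have "(\<lambda>n. jac_approx \<pi> (Suc n) z) \<longlonglongrightarrow> 1 / l" by simp
  then have "(\<lambda>n. jac_approx \<pi> n z) \<longlonglongrightarrow> 1 / l" by (rule LIMSEQ_imp_Suc)
  then show "jac \<pi> z = 1 / l" by (simp add: jac_def limI)
qed

text \<open>
  The third claim is Fatou's lemma for \<open>g\<close> times the likelihood ratios; the finiteness of the integral
  also excludes the limit \<open>\<infinity>\<close> of the ratios, that is, \<open>J = 0\<close>.
\<close>

lemma AE_jac_limit:
  assumes g: "\<And>z. g (truncation 2 z) = g z" "\<And>z. 0 < g z" and total: "lift_integral (marginal_seq \<pi>) g \<le> 1"
  shows "AE z in \<pi>. 0 < jac \<pi> z \<and> jac \<pi> z \<le> 1"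
    and "integrable \<pi> (\<lambda>z. g z / jac \<pi> z)" "(\<integral>z. g z / jac \<pi> z \<partial>\<pi>) \<le> 1"
proof -
  let ?u = "\<lambda>n z. ennreal (g z * likelihood_ratio \<pi> (Suc n) z)"
  have gt: "g (truncation (Suc (Suc n)) z) = g z" for n z
    by (rule truncation_function_mono[where g = g and m = 2, OF g(1)]) simp
  have L: "integrable \<pi> (\<lambda>z. g z * likelihood_ratio \<pi> (Suc n) z)"
      "(\<integral>z. g z * likelihood_ratio \<pi> (Suc n) z \<partial>\<pi>) = lift_integral (marginal_seq \<pi>) (\<lambda>z. g z * indicator {z. 0 < measure \<pi> (block (Suc (Suc n)) z)} z)" for n
    by (rule integral_likelihood_ratio[where g = g, OF inv]; rule gt)+
  have nonneg: "0 \<le> g z * likelihood_ratio \<pi> n z" for n z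
    using g(2)[of z] by (simp add: likelihood_ratio_def)
  have "(\<integral>\<^sup>+z. ?u n z \<partial>\<pi>) \<le> 1" for n
  proof -
    have "(\<integral>z. g z * likelihood_ratio \<pi> (Suc n) z \<partial>\<pi>) \<le> lift_integral (marginal_seq \<pi>) g"
      unfolding L(2) by (rule lift_integral_mono[OF inv, of _ "Suc n" _ "Suc n"])
        (use g(2) in \<open>auto simp: gt block_truncation indicator_def less_imp_le\<close>)
    then show ?thesis using total L(1) nonneg
      by (subst nn_integral_eq_integral) auto
  qed
  then have "liminf (\<lambda>n. \<integral>\<^sup>+z. ?u n z \<partial>\<pi>) \<le> 1"
    by (intro order_trans[OF Liminf_le_Limsup Limsup_bounded]) auto
  moreover have um: "?u n \<in> borel_measurable \<pi>" for n using borel_measurable_integrable[OF L(1)] by simp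
  ultimately have fatou: "(\<integral>\<^sup>+z. liminf (\<lambda>n. ?u n z) \<partial>\<pi>) \<le> 1"
    using nn_integral_liminf[of ?u \<pi>] by (meson order_trans)
  then have "(\<integral>\<^sup>+z. liminf (\<lambda>n. ?u n z) \<partial>\<pi>) \<noteq> \<infinity>" by (auto simp: top_unique)
  then have fin: "AE z in \<pi>. liminf (\<lambda>n. ?u n z) \<noteq> \<infinity>"
    by (intro nn_integral_PInf_AE borel_measurable_liminf um)
  have AE: "AE z in \<pi>. 0 < jac \<pi> z \<and> jac \<pi> z \<le> 1 \<and> liminf (\<lambda>n. ?u n z) = ennreal (g z / jac \<pi> z)"
    using likelihood_ratio_converges[OF inv] AE_block_pos fin
  proof eventually_elim
    case (elim z)
    then obtain L where lim: "(\<lambda>n. ereal (likelihood_ratio \<pi> n z)) \<longlonglongrightarrow> L" by blast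
    have "L \<noteq> \<infinity>"
    proof
      assume "L = \<infinity>"
      have "ennreal r \<le> liminf (\<lambda>n. ?u n z)" for r
      proof (rule Liminf_bounded)
        have "\<forall>\<^sub>F n in sequentially. ereal (r / g z) < ereal (likelihood_ratio \<pi> n z)"
          using lim unfolding \<open>L = \<infinity>\<close> tendsto_PInfty by simp
        then have "\<forall>\<^sub>F n in sequentially. ereal (r / g z) < ereal (likelihood_ratio \<pi> (Suc n) z)"
          by (subst eventually_sequentially_Suc)
        then show "\<forall>\<^sub>F n in sequentially. ennreal r \<le> ?u n z"
          by eventually_elim (use g(2)[of z] in \<open>auto intro!: ennreal_leI simp: pos_divide_less_eq mult.commute\<close>)
      qed
      moreover obtain c where "0 \<le> c" "liminf (\<lambda>n. ?u n z) = ennreal c"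
        using elim by (metis ennreal_cases infinity_ennreal_def)
      ultimately have "ennreal (c + 1) \<le> ennreal c" by metis
      then show False using \<open>0 \<le> c\<close> by simp
    qed
    moreover have "0 \<le> L" using lim by (rule LIMSEQ_le_const) (auto simp: likelihood_ratio_def)
    ultimately obtain l where "L = ereal l" by (cases L) auto
    then have l: "(\<lambda>n. likelihood_ratio \<pi> n z) \<longlonglongrightarrow> l" using lim by simp
    have J: "1 \<le> l" "jac \<pi> z = 1 / l"
      using jac_eq_inverse_limit[OF _ l] elim by auto
    have "(\<lambda>n. likelihood_ratio \<pi> (Suc n) z) \<longlonglongrightarrow> l" using l by (rule LIMSEQ_Suc)
    then have "(\<lambda>n. ?u n z) \<longlonglongrightarrow> ennreal (g z * l)"
      by (intro tendsto_ennrealI tendsto_mult_left)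
    then have "liminf (\<lambda>n. ?u n z) = ennreal (g z * l)"
      by (intro lim_imp_Liminf) auto
    then show ?case using J by simp
  qed
  then show "AE z in \<pi>. 0 < jac \<pi> z \<and> jac \<pi> z \<le> 1" by eventually_elim auto
  have "(\<integral>\<^sup>+z. ennreal (g z / jac \<pi> z) \<partial>\<pi>) = (\<integral>\<^sup>+z. liminf (\<lambda>n. ?u n z) \<partial>\<pi>)"
    by (rule nn_integral_cong_AE) (use AE in eventually_elim, auto)
  then have le: "(\<integral>\<^sup>+z. ennreal (g z / jac \<pi> z) \<partial>\<pi>) \<le> 1" using fatou by simp
  have gm: "g \<in> borel_measurable \<pi>"
    using truncation_function_measurable[of g, OF g(1)] measurable_cong_sets[OF sets_plan[OF inv] refl] by blast
  have nn: "AE z in \<pi>. 0 \<le> g z / jac \<pi> z"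
    using AE by eventually_elim (use g(2) in \<open>auto intro!: divide_nonneg_pos simp: less_imp_le\<close>)
  show int: "integrable \<pi> (\<lambda>z. g z / jac \<pi> z)"
    using le nn gm jac_measurable by (intro integrableI_nonneg) (auto simp: less_top[symmetric] top_unique)
  show "(\<integral>z. g z / jac \<pi> z \<partial>\<pi>) \<le> 1"
    using le nn_integral_eq_integral[OF int nn] by simp
qed

lemma gibbs_inequality:
  fixes w :: "2 \<Rightarrow> 2 \<Rightarrow> 2 \<Rightarrow> real"
  assumes w: "\<And>x i j. 0 < w x i j" and sum1: "\<And>j. (\<Sum>x\<in>UNIV. \<Sum>i\<in>UNIV. w x i j) = 1"
  shows "plan_entropy \<pi> \<le> - (\<integral>(x, y). ln (w x (y 0) (y 1)) \<partial>\<pi>)"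
proof -
  define g where "g z = w (fst z) (snd z 0) (snd z 1)" for z :: "2 \<times> seq"
  have g: "g (truncation 2 z) = g z" "0 < g z" for z by (simp_all add: g_def truncation_def w)
  have int: "integrable (marginal_seq \<pi>) (\<lambda>y. w x i (y 0))" for x i
    using lift_integral_truncation_function(1)[where g = g and m = 1 and x = x and a = i, OF \<nu>.finite_measure_axioms sets_marginal_seq]
    g(1) by (simp add: g_def numeral_2_eq_2)
  have "lift_integral (marginal_seq \<pi>) g = (\<integral>y. (\<Sum>x\<in>UNIV. \<Sum>i\<in>UNIV. w x i (y 0)) \<partial>marginal_seq \<pi>)"
    using int by (simp add: lift_integral_def g_def Bochner_Integration.integral_sum Bochner_Integration.integrable_sum)
  also have "\<dots> = 1" using \<nu>.prob_space by (simp add: sum1)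
  finally have total: "lift_integral (marginal_seq \<pi>) g \<le> 1" by simp
  note J = AE_jac_limit[OF g total]
  have lng: "integrable \<pi> (\<lambda>z. ln (g z))"
    by (rule integral_truncation_function[where n = 2, OF finite_measure_axioms sets_plan[OF inv]]) (simp add: g)
  \<comment> \<open>the lower bound makes \<open>ln J\<close> integrable, so that the entropy is a genuine integral\<close>
  have bound: "AE z in \<pi>. 0 \<le> - ln (jac \<pi> z) \<and> - ln (jac \<pi> z) \<le> g z / jac \<pi> z - 1 - ln (g z)"
    using J(1)
  proof eventually_elim
    case (elim z)
    have "ln (g z / jac \<pi> z) \<le> g z / jac \<pi> z - 1"
      using elim g(2)[of z] by (intro ln_le_minus_one) simp
    then show ?case using elim g(2)[of z] by (simp add: ln_div)
  qed
  have intb: "integrable \<pi> (\<lambda>z. g z / jac \<pi> z - 1 - ln (g z))"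
    using J(2) lng by simp
  then have intJ: "integrable \<pi> (\<lambda>z. - ln (jac \<pi> z))"
    by (rule Bochner_Integration.integrable_bound) (use jac_measurable bound in auto)
  have "plan_entropy \<pi> = (\<integral>z. - ln (jac \<pi> z) \<partial>\<pi>)" by (simp add: plan_entropy_def)
  also have "\<dots> \<le> (\<integral>z. g z / jac \<pi> z - 1 - ln (g z) \<partial>\<pi>)"
    by (rule integral_mono_AE[OF intJ intb]) (use bound in auto)
  also have "\<dots> = (\<integral>z. g z / jac \<pi> z \<partial>\<pi>) - 1 - (\<integral>z. ln (g z) \<partial>\<pi>)"
    using J(2) lng by (simp add: prob_space)
  also have "\<dots> \<le> - (\<integral>z. ln (g z) \<partial>\<pi>)" using J(3) by simp
  finally show ?thesis by (simp add: g_def case_prod_beta')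
qed

end

section \<open>Stationary Markov measures\<close>

lemma seq_measure_eqI:
  assumes N: "finite_measure N" "sets N = sets seq_space" and N': "sets N' = sets seq_space"
    and eq: "\<And>n y. emeasure N (cylinder n y) = emeasure N' (cylinder n y)"
  shows "N = N'"
proof -
  define E where "E = insert {} {cylinder n y |n y. True}"
  have cyl_E: "cylinder n y \<in> E" for n y by (auto simp: E_def)
  have int: "cylinder m x \<inter> cylinder n y \<in> E" for m n x y
  proof (cases "cylinder m x \<inter> cylinder n y = {}")
    case False
    then obtain u where "u \<in> cylinder m x \<inter> cylinder n y" by blast
    then have "cylinder m x \<inter> cylinder n y = cylinder (max m n) u"
      by (auto simp: cylinder_def less_max_iff_disj)
    then show ?thesis by (simp add: cyl_E)
  qed (simp add: E_def)
  have E_cases: "A = {} \<or> (\<exists>n y. A = cylinder n y)" if "A \<in> E" for A using that by (auto simp: E_def)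
  have empty_E: "{} \<in> E" by (simp add: E_def)
  show ?thesis
  proof (rule measure_eqI_generator_eq[where E = E and \<Omega> = UNIV and A = "\<lambda>_. UNIV"])
    show "Int_stable E"
      unfolding Int_stable_def using E_cases int empty_E by (metis Int_empty_left Int_empty_right)
    have "sigma_sets UNIV E = sets seq_space"
    proof
      show "sigma_sets UNIV E \<subseteq> sets seq_space"
      proof -
        have "E \<subseteq> sets seq_space" by (auto simp: E_def cylinder_in_sets)
        from sets.sigma_sets_subset[OF this] show ?thesis by (simp add: space_seq_space)
      qed
      have "U \<in> sigma_sets UNIV E" if U: "openin seq_top U" for U
      proof -
        interpret S: sigma_algebra UNIV "sigma_sets UNIV E"
          by (rule sigma_algebra_sigma_sets) auto
        have "U = \<Union>{A \<in> {cylinder n y | n y. True}. A \<subseteq> U}"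
        proof (intro equalityI subsetI)
          fix y assume "y \<in> U"
          then obtain n where "cylinder n y \<subseteq> U" using U by (auto simp: openin_seq_top)
          moreover have "y \<in> cylinder n y" by (simp add: cylinder_def)
          ultimately show "y \<in> \<Union>{A \<in> {cylinder n y | n y. True}. A \<subseteq> U}" by blast
        qed auto
        moreover have "\<Union>{A \<in> {cylinder n y | n y. True}. A \<subseteq> U} \<in> sigma_sets UNIV E"
          by (rule S.countable_Union) (auto intro: sigma_sets.Basic cyl_E countable_subset[OF _ countable_cylinders])
        ultimately show ?thesis by simp
      qed
      then show "sets seq_space \<subseteq> sigma_sets UNIV E"
        unfolding sets_seq_space by (intro sigma_sets_mono) auto
    qed
    then show "sets N = sigma_sets UNIV E"
      "sets N' = sigma_sets UNIV E" using N N' by auto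
    show "range (\<lambda>_::nat. UNIV) \<subseteq> E" using cyl_E[of 0] by (auto simp: cylinder_def)
    show "emeasure N UNIV \<noteq> \<infinity>" 
      using finite_measure.emeasure_finite[OF N(1)] by simp
    show "emeasure N X = emeasure N' X" if "X \<in> E" for X
      using that eq by (auto simp: E_def)
  qed auto
qed

lemma pmf_2_exists:
  fixes f :: "2 \<Rightarrow> real"
  assumes "\<And>x. 0 \<le> f x" "(\<Sum>x\<in>UNIV. f x) = 1"
  shows "\<exists>q. \<forall>x. pmf q x = f x"
proof (intro exI allI)
  fix x
  have "(\<integral>\<^sup>+x. ennreal (f x) \<partial>count_space UNIV) = 1"
    using assms by (simp add: nn_integral_count_space_finite sum_ennreal)
  then show "pmf (embed_pmf f) x = f x" using assms(1) by (intro pmf_embed_pmf) auto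
qed

text \<open>
  A Markov chain driven by independent symbols: \<open>\<omega> (k + 1, i)\<close> is the move made at time \<open>k + 1\<close> if the chain
  is then at \<open>i\<close>. Only \<open>\<omega> (0, 1)\<close> is used at time \<open>0\<close>.
\<close>

fun chain_path :: "(nat \<times> 2 \<Rightarrow> 2) \<Rightarrow> nat \<Rightarrow> 2" where
  "chain_path \<omega> 0 = \<omega> (0, 1)"
| "chain_path \<omega> (Suc k) = \<omega> (Suc k, chain_path \<omega> k)"

lemma markov_measure_exists:
  fixes P :: "2 \<Rightarrow> 2 \<Rightarrow> real" and \<nu> :: "2 \<Rightarrow> real"
  assumes P: "\<And>i j. 0 \<le> P i j" "\<And>i. (\<Sum>j\<in>UNIV. P i j) = 1"
    and \<nu>: "\<And>i. 0 \<le> \<nu> i" "(\<Sum>i\<in>UNIV. \<nu> i) = 1"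
  obtains N where "prob_space N" "sets N = sets seq_space"
    "\<And>n y. measure N (cylinder (Suc n) y) = \<nu> (y 0) * (\<Prod>k<n. P (y k) (y (Suc k)))"
proof -
  obtain q0 where q0: "\<And>i. pmf q0 i = \<nu> i" using pmf_2_exists[of \<nu>] \<nu> by blast
  obtain q where q: "\<And>i j. pmf (q i) j = P i j" using pmf_2_exists[of "P _"] P by metis
  define M where "M = (\<lambda>(k::nat, i). measure_pmf (if k = 0 then q0 else q i))"
  interpret M: product_prob_space M UNIV
    by unfold_locales (auto simp: M_def split: prod.split intro: prob_space_imp_sigma_finite prob_space.emeasure_space_1 measure_pmf.prob_space_axioms)
  let ?M = "Pi\<^sub>M UNIV M"
  have sets_M: "sets (M z) = UNIV" "space (M z) = UNIV" for z by (auto simp: M_def split: prod.split)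
  have comp: "(\<lambda>\<omega>. \<omega> z) \<in> measurable ?M (count_space UNIV)" for z
    using measurable_component_singleton[of z UNIV M] measurable_cong_sets[OF refl, of "M z" "count_space UNIV" ?M]
    by (simp add: sets_M)
  have path: "(\<lambda>\<omega>. chain_path \<omega> k) \<in> measurable ?M (count_space UNIV)" for k
  proof (induction k)
    case (Suc k)
    have "(\<lambda>\<omega>. (\<lambda>i \<omega>. \<omega> (Suc k, i)) (chain_path \<omega> k) \<omega>) \<in> measurable ?M (count_space UNIV)"
      by (rule measurable_compose_countable[OF comp Suc])
    then show ?case by simp
  qed (simp add: comp)
  have path_m: "chain_path \<in> measurable ?M seq_space"
    unfolding seq_space_def by (intro measurable_PiM_single') (auto simp: path space_PiM)
  define N where "N = distr ?M seq_space chain_path"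
  show thesis
  proof
    show "prob_space N" unfolding N_def by (rule M.P.prob_space_distr[OF path_m])
    show "sets N = sets seq_space" by (simp add: N_def)
    fix n and y :: seq
    define idx where "idx = (\<lambda>k. case k of 0 \<Rightarrow> (0::nat, 1::2) | Suc k \<Rightarrow> (Suc k, y k))"
    have fst_idx: "fst (idx k) = k" for k by (auto simp: idx_def split: nat.split)
    have inj: "inj_on idx {..<Suc n}" by (rule inj_on_inverseI[of _ fst]) (rule fst_idx)
    let ?J = "idx ` {..<Suc n}"
    have path_eq: "(\<forall>k<m. chain_path \<omega> k = y k) \<longleftrightarrow> (\<forall>k<m. \<omega> (idx k) = y k)" for \<omega> m
    proof (induction m)
      case (Suc m)
      show ?case
        using Suc by (cases m) (auto simp: less_Suc_eq idx_def)
    qed simp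
    have "chain_path -` cylinder (Suc n) y \<inter> space ?M = {\<omega>. \<forall>k<Suc n. \<omega> (idx k) = y k}"
      unfolding cylinder_def using path_eq[of "Suc n"] by (auto simp: space_PiM sets_M)
    also have "\<dots> = prod_emb UNIV M ?J (Pi\<^sub>E ?J (\<lambda>z. {y (fst z)}))"
      by (auto simp: prod_emb_def fst_idx PiE_iff sets_M)
    finally have pre: "chain_path -` cylinder (Suc n) y \<inter> space ?M = prod_emb UNIV M ?J (Pi\<^sub>E ?J (\<lambda>z. {y (fst z)}))" .
    have "measure N (cylinder (Suc n) y) = measure ?M (prod_emb UNIV M ?J (Pi\<^sub>E ?J (\<lambda>z. {y (fst z)})))"
      unfolding N_def by (subst measure_distr[OF path_m]) (simp_all add: cylinder_in_sets pre)
    also have "\<dots> = (\<Prod>z\<in>?J. measure (M z) {y (fst z)})"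
      by (rule M.measure_PiM_emb) (auto simp: sets_M)
    also have "\<dots> = (\<Prod>k<Suc n. measure (M (idx k)) {y k})"
      by (subst prod.reindex[OF inj]) (simp add: fst_idx)
    also have "\<dots> = \<nu> (y 0) * (\<Prod>k<n. P (y k) (y (Suc k)))"
      unfolding prod.lessThan_Suc_shift by (simp add: M_def idx_def measure_pmf_single q0 q)
    finally show "measure N (cylinder (Suc n) y) = \<nu> (y 0) * (\<Prod>k<n. P (y k) (y (Suc k)))" .
  qed
qed

text \<open>
  The columns of \<open>Q\<close> are the transition probabilities of the time-reversed chain: \<open>Q i j\<close> is the probability
  that the symbol \<open>j\<close> is preceded by \<open>i\<close>.
\<close>

lemma stationary_measure_exists:
  fixes Q :: "2 \<Rightarrow> 2 \<Rightarrow> real"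
  assumes Q: "\<And>i j. 0 < Q i j" "\<And>j. (\<Sum>i\<in>UNIV. Q i j) = 1"
  obtains N \<nu> where "prob_space N" "sets N = sets seq_space" "\<And>i. 0 < \<nu> i" "(\<Sum>i\<in>UNIV. \<nu> i) = 1"
    "\<And>i. (\<Sum>j\<in>UNIV. Q i j * \<nu> j) = \<nu> i"
    "\<And>n y. measure N (cylinder (Suc n) y) = (\<Prod>k<n. Q (y k) (y (Suc k))) * \<nu> (y n)"
    "distr N seq_space shift = N"
proof -
  define \<nu> where "\<nu> i = (if i = 1 then Q 1 2 else Q 2 1) / (Q 1 2 + Q 2 1)" for i :: 2
  have D: "0 < Q 1 2 + Q 2 1" using Q by (simp add: add_pos_pos)
  have \<nu>: "0 < \<nu> i" for i using Q D by (simp add: \<nu>_def)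
  have \<nu>1: "(\<Sum>i\<in>UNIV. \<nu> i) = 1" using D by (simp add: \<nu>_def sum_2 add_divide_distrib[symmetric])
  have st: "(\<Sum>j\<in>UNIV. Q i j * \<nu> j) = \<nu> i" for i
  proof -
    have "(\<Sum>j\<in>UNIV. Q i j * \<nu> j) = (Q i 1 * Q 1 2 + Q i 2 * Q 2 1) / (Q 1 2 + Q 2 1)"
      by (simp add: \<nu>_def sum_2 add_divide_distrib)
    moreover have "Q 1 1 * Q 1 2 + Q 1 2 * Q 2 1 = Q 1 2 * (Q 1 1 + Q 2 1)"
      "Q 2 1 * Q 1 2 + Q 2 2 * Q 2 1 = Q 2 1 * (Q 1 2 + Q 2 2)" by (simp_all add: algebra_simps)
    moreover have "Q 1 1 + Q 2 1 = 1" "Q 1 2 + Q 2 2 = 1" using Q(2)[of 1] Q(2)[of 2] by (simp_all add: sum_2)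
    moreover have "i = 1 \<or> i = 2" by (rule exhaust_2)
    ultimately show ?thesis by (auto simp: \<nu>_def)
  qed
  \<comment> \<open>transition probabilities in the forward direction\<close>
  define P where "P i j = Q i j * \<nu> j / \<nu> i" for i j
  have P: "0 \<le> P i j" "(\<Sum>j\<in>UNIV. P i j) = 1" for i j
    using Q(1)[of i j] \<nu>[of i] \<nu>[of j] st[of i] by (simp_all add: P_def sum_divide_distrib[symmetric])
  obtain N where N: "prob_space N" "sets N = sets seq_space"
    "\<And>n y. measure N (cylinder (Suc n) y) = \<nu> (y 0) * (\<Prod>k<n. P (y k) (y (Suc k)))"
    using markov_measure_exists[of P \<nu>, OF P less_imp_le[OF \<nu>] \<nu>1] by blast
  interpret N: prob_space N by fact
  have cyl: "measure N (cylinder (Suc n) y) = (\<Prod>k<n. Q (y k) (y (Suc k))) * \<nu> (y n)" for n y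
  proof -
    have "\<nu> (y 0) * (\<Prod>k<n. P (y k) (y (Suc k))) = (\<Prod>k<n. Q (y k) (y (Suc k))) * \<nu> (y n)"
    proof (induction n)
      case (Suc n)
      have "\<nu> (y 0) * (\<Prod>k<Suc n. P (y k) (y (Suc k))) = (\<nu> (y 0) * (\<Prod>k<n. P (y k) (y (Suc k)))) * P (y n) (y (Suc n))"
        by simp
      also have "\<dots> = (\<Prod>k<Suc n. Q (y k) (y (Suc k))) * \<nu> (y (Suc n))"
        unfolding Suc using \<nu>[of "y n"] by (simp add: P_def)
      finally show ?case .
    qed simp
    then show ?thesis by (simp add: N)
  qed
  have spN: "space N = UNIV" using sets_eq_imp_space_eq[OF N(2)] by (simp add: space_seq_space)
  have shN: "shift \<in> measurable N seq_space"
    using shift_measurable measurable_cong_sets[OF N(2) refl] by blast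
  have cylN: "cylinder n y \<in> sets N" for n y by (simp add: N(2) cylinder_in_sets)
  have "distr N seq_space shift = N"
  proof (rule seq_measure_eqI)
    interpret D: prob_space "distr N seq_space shift" by (rule N.prob_space_distr[OF shN])
    show "finite_measure (distr N seq_space shift)" by (rule D.finite_measure_axioms)
    have "measure (distr N seq_space shift) (cylinder n y) = measure N (cylinder n y)" for n y
    proof (cases n)
      case 0
      then show ?thesis using N.prob_space D.prob_space by (simp add: cylinder_def spN space_seq_space)
    next
      case (Suc m)
      have "measure (distr N seq_space shift) (cylinder n y) = measure N (shift -` cylinder n y)"
        by (subst measure_distr[OF shN]) (simp_all add: cylinder_in_sets spN)
      also have "shift -` cylinder n y = (\<Union>a\<in>UNIV. cylinder (Suc n) (case_nat a y))"
        by (auto simp: cylinder_def shift_def All_less_Suc2)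
      also have "measure N \<dots> = (\<Sum>a\<in>UNIV. measure N (cylinder (Suc n) (case_nat a y)))"
        by (rule N.finite_measure_finite_Union, simp) (use cylN in blast, auto simp: disjoint_family_on_def cylinder_def)
      also have "\<dots> = (\<Sum>a\<in>UNIV. Q a (y 0)) * ((\<Prod>k<m. Q (y k) (y (Suc k))) * \<nu> (y m))"
        unfolding cyl Suc prod.lessThan_Suc_shift by (simp add: sum_distrib_right mult.assoc)
      also have "\<dots> = measure N (cylinder n y)" by (simp add: Q(2) cyl Suc)
      finally show ?thesis .
    qed
    then show "emeasure (distr N seq_space shift) (cylinder n y) = emeasure N (cylinder n y)" for n y
      by (simp add: N.emeasure_eq_measure D.emeasure_eq_measure)
  qed (simp_all add: N)
  then show thesis using that N \<nu> \<nu>1 st cyl by blast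
qed

section \<open>Plans with prescribed Jacobian\<close>

text \<open>
  The sequence follows the stationary chain whose reversed transitions are \<open>\<Sum>\<^sub>x w x i j\<close>, and the symbol is
  chosen with probability proportional to \<open>w x (y 0) (y 1)\<close>. Zero entries of \<open>w\<close> are allowed, as they occur
  when the symbol is deterministic.
\<close>

lemma gibbs_plan_exists:
  fixes w :: "2 \<Rightarrow> 2 \<Rightarrow> 2 \<Rightarrow> real"
  assumes w: "\<And>x i j. 0 \<le> w x i j" "\<And>i j. 0 < (\<Sum>x\<in>UNIV. w x i j)"
    and sum1: "\<And>j. (\<Sum>x\<in>UNIV. \<Sum>i\<in>UNIV. w x i j) = 1"
  obtains \<pi> \<nu> where "\<pi> \<in> invariant_plans" "\<And>i. 0 < \<nu> i" "(\<Sum>i\<in>UNIV. \<nu> i) = 1"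
    "\<And>i. (\<Sum>x\<in>UNIV. \<Sum>j\<in>UNIV. w x i j * \<nu> j) = \<nu> i"
    "\<And>g. (\<integral>(x, y). g x (y 0) (y 1) \<partial>\<pi>) = (\<Sum>x\<in>UNIV. \<Sum>i\<in>UNIV. \<Sum>j\<in>UNIV. g x i j * (w x i j * \<nu> j))"
    "\<And>x y. jac \<pi> (x, y) = w x (y 0) (y 1)"
proof -
  define Q where "Q i j = (\<Sum>x\<in>UNIV. w x i j)" for i j
  have Q: "0 < Q i j" "(\<Sum>i\<in>UNIV. Q i j) = 1" for i j
    using w sum1[of j] sum.swap[of "\<lambda>x i. w x i j" UNIV UNIV] by (simp_all add: Q_def)
  obtain N \<nu> where N: "prob_space N" "sets N = sets seq_space" and \<nu>: "\<And>i. 0 < \<nu> i" "(\<Sum>i\<in>UNIV. \<nu> i) = 1"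
    and st: "\<And>i. (\<Sum>j\<in>UNIV. Q i j * \<nu> j) = \<nu> i"
    and cyl: "\<And>n y. measure N (cylinder (Suc n) y) = (\<Prod>k<n. Q (y k) (y (Suc k))) * \<nu> (y n)"
    and inv: "distr N seq_space shift = N"
    by (rule stationary_measure_exists[of Q, OF Q]) (rule that)
  interpret N: prob_space N by fact
  define G where "G z = w (fst z) (snd z 0) (snd z 1) / Q (snd z 0) (snd z 1)" for z :: "2 \<times> seq"
  have G: "0 \<le> G z" "G (truncation 2 z) = G z" for z
    using w(1) Q(1) by (simp_all add: G_def truncation_def less_imp_le)
  have spN: "space N = UNIV" using sets_eq_imp_space_eq[OF N(2)] by (simp add: space_seq_space)
  let ?K = "count_space UNIV :: 2 measure"
  have sets_KN: "sets (?K \<Otimes>\<^sub>M N) = sets plan_space"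
    unfolding plan_space_def by (rule sets_pair_measure_cong) (simp_all add: N)
  have [measurable]: "G \<in> borel_measurable (?K \<Otimes>\<^sub>M N)"
    using truncation_function_measurable[where g = G and n = 2, OF G(2)] measurable_cong_sets[OF sets_KN refl] by blast
  have Gm: "(\<lambda>z. ennreal (G z)) \<in> borel_measurable (?K \<Otimes>\<^sub>M N)" by measurable
  define \<pi> where "\<pi> = density (?K \<Otimes>\<^sub>M N) (\<lambda>z. ennreal (G z))"
  have sets_pi: "sets \<pi> = sets plan_space" by (simp add: \<pi>_def sets_KN)
  have sp_pi: "space \<pi> = UNIV" using sets_eq_imp_space_eq[OF sets_pi] by (simp add: space_plan_space)
  have em: "emeasure \<pi> (X \<times> A) = (\<Sum>x\<in>X. \<integral>\<^sup>+y. ennreal (G (x, y)) * indicator A y \<partial>N)"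
    if A: "A \<in> sets seq_space" for X A
  proof -
    have XA: "X \<times> A \<in> sets (?K \<Otimes>\<^sub>M N)" using A N by (intro pair_measureI) auto
    have "emeasure \<pi> (X \<times> A) = (\<integral>\<^sup>+z. ennreal (G z) * indicator (X \<times> A) z \<partial>(?K \<Otimes>\<^sub>M N))"
      unfolding \<pi>_def by (rule emeasure_density[OF Gm XA])
    also have "\<dots> = (\<integral>\<^sup>+x. \<integral>\<^sup>+y. ennreal (G (x, y)) * indicator (X \<times> A) (x, y) \<partial>N \<partial>?K)"
      by (rule N.nn_integral_fst[symmetric]) (intro borel_measurable_times_ennreal Gm borel_measurable_indicator XA)
    also have "\<dots> = (\<Sum>x\<in>UNIV. \<integral>\<^sup>+y. ennreal (G (x, y)) * indicator (X \<times> A) (x, y) \<partial>N)"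
      by (simp add: nn_integral_count_space_finite)
    also have "\<dots> = (\<Sum>x\<in>UNIV. if x \<in> X then \<integral>\<^sup>+y. ennreal (G (x, y)) * indicator A y \<partial>N else 0)"
      by (intro sum.cong refl) (auto simp: indicator_def)
    also have "\<dots> = (\<Sum>x\<in>X. \<integral>\<^sup>+y. ennreal (G (x, y)) * indicator A y \<partial>N)"
      by (simp add: sum.inter_filter[symmetric])
    finally show ?thesis .
  qed
  have sumG: "(\<Sum>x\<in>UNIV. G (x, y)) = 1" for y
    using Q(1)[of "y 0" "y 1"] by (simp add: G_def sum_divide_distrib[symmetric]) (simp add: Q_def)
  have Gy: "(\<lambda>y. ennreal (G (x, y))) \<in> borel_measurable N" for x
    using measurable_Pair2[OF Gm] by simp
  have full: "emeasure \<pi> (UNIV \<times> A) = emeasure N A" if A: "A \<in> sets seq_space" for A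
  proof -
    have "emeasure \<pi> (UNIV \<times> A) = (\<integral>\<^sup>+y. (\<Sum>x\<in>UNIV. ennreal (G (x, y)) * indicator A y) \<partial>N)"
      unfolding em[OF A] using A N Gy by (intro nn_integral_sum[symmetric]) auto
    also have "\<dots> = (\<integral>\<^sup>+y. indicator A y \<partial>N)"
      using sumG G(1) by (simp add: sum_distrib_right[symmetric] sum_ennreal)
    finally show ?thesis using A N by simp
  qed
  have "emeasure \<pi> (space \<pi>) = 1"
    using full[of UNIV] N.emeasure_space_1 sets.top[of seq_space] by (simp add: sp_pi spN space_seq_space)
  then have pi: "prob_space \<pi>" by (rule prob_spaceI)
  interpret P: prob_space \<pi> by (rule pi)
  have snd_pi: "snd \<in> measurable \<pi> seq_space"
    using snd_measurable measurable_cong_sets[OF sets_pi refl] by blast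
  have marg: "marginal_seq \<pi> = N"
  proof (rule measure_eqI)
    show "sets (marginal_seq \<pi>) = sets N" by (simp add: N)
    fix A assume "A \<in> sets (marginal_seq \<pi>)"
    then have A: "A \<in> sets seq_space" by simp
    have "emeasure (marginal_seq \<pi>) A = emeasure \<pi> (snd -` A \<inter> space \<pi>)"
      unfolding marginal_seq_def by (rule emeasure_distr[OF snd_pi A])
    also have "snd -` A \<inter> space \<pi> = UNIV \<times> A" by (auto simp: sp_pi)
    finally show "emeasure (marginal_seq \<pi>) A = emeasure N A" by (simp add: full[OF A])
  qed
  have invp: "\<pi> \<in> invariant_plans"
    by (simp add: invariant_plans_def plans_def pi sets_pi marg inv)
  have block: "measure \<pi> (block (Suc (Suc n)) z) = w (fst z) (snd z 0) (snd z 1) * measure N (cylinder (Suc n) (shift (snd z)))" for n z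
  proof -
    let ?C = "cylinder (Suc (Suc n)) (snd z)"
    have "emeasure \<pi> (block (Suc (Suc n)) z) = (\<integral>\<^sup>+y. ennreal (G (fst z, y)) * indicator ?C y \<partial>N)"
      unfolding block_def using em[OF cylinder_in_sets, of "{fst z}"] by simp
    also have "\<dots> = (\<integral>\<^sup>+y. ennreal (G z) * indicator ?C y \<partial>N)"
      by (intro nn_integral_cong) (auto simp: G_def cylinder_def indicator_def)
    also have "\<dots> = ennreal (G z * measure N ?C)"
      using cylinder_in_sets N G(1) by (simp add: nn_integral_cmult_indicator N.emeasure_eq_measure ennreal_mult)
    finally have "measure \<pi> (block (Suc (Suc n)) z) = G z * measure N ?C"
      using G(1) by (simp add: measure_def)
    also have "\<dots> = w (fst z) (snd z 0) (snd z 1) * measure N (cylinder (Suc n) (shift (snd z)))"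
      unfolding cyl prod.lessThan_Suc_shift using Q(1)[of "snd z 0" "snd z 1"] by (simp add: G_def shift_def)
    finally show ?thesis .
  qed
  have Npos: "0 < measure N (cylinder n y)" for n y
  proof (cases n)
    case 0
    then show ?thesis using N.prob_space by (simp add: cylinder_def spN)
  next
    case (Suc m)
    then show ?thesis by (simp add: cyl \<nu> Q prod_pos)
  qed
  have jac: "jac \<pi> (x, y) = w x (y 0) (y 1)" for x y
  proof -
    have "jac_approx \<pi> (Suc (Suc n)) (x, y) = w x (y 0) (y 1)" for n
    proof -
      have "measure N (cylinder (Suc n) (shift y)) \<noteq> 0" using Npos[of "Suc n" "shift y"] by linarith
      then show ?thesis using block[of n "(x, y)"] by (simp add: jac_approx_eq[OF invp] marg Npos)
    qed
    then have "(\<lambda>n. jac_approx \<pi> (Suc (Suc n)) (x, y)) \<longlonglongrightarrow> w x (y 0) (y 1)" by simp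
    then have "(\<lambda>n. jac_approx \<pi> n (x, y)) \<longlonglongrightarrow> w x (y 0) (y 1)" by (rule LIMSEQ_imp_Suc[OF LIMSEQ_imp_Suc])
    then show ?thesis by (simp add: jac_def limI)
  qed
  have int: "(\<integral>(x, y). g x (y 0) (y 1) \<partial>\<pi>) = (\<Sum>x\<in>UNIV. \<Sum>i\<in>UNIV. \<Sum>j\<in>UNIV. g x i j * (w x i j * \<nu> j))" for g
  proof -
    define e where "e x i j = (x, \<lambda>k::nat. if k = 0 then i else j)" for x i j :: 2
    have e: "measure \<pi> (block 2 (e x i j)) = w x i j * \<nu> j" for x i j
      using block[of 0 "e x i j"] by (simp add: cyl numeral_2_eq_2 e_def shift_def)
    have bs: "block 2 z \<in> sets \<pi>" for z by (simp add: sets_pi block_in_sets)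
    have ind: "(x, y) \<in> block 2 (e x' i j) \<longleftrightarrow> x' = x \<and> i = y 0 \<and> j = y 1" for x x' i j y
      by (auto simp: block_def e_def cylinder_def numeral_2_eq_2 All_less_Suc)
    have ge: "(case z of (x, y) \<Rightarrow> g x (y 0) (y 1)) = (\<Sum>x\<in>UNIV. \<Sum>i\<in>UNIV. \<Sum>j\<in>UNIV. g x i j * indicator (block 2 (e x i j)) z)" for z
    proof (cases z)
      case (Pair x y)
      have "(\<Sum>x'\<in>UNIV. \<Sum>i\<in>UNIV. \<Sum>j\<in>UNIV. g x' i j * indicator (block 2 (e x' i j)) z)
          = (\<Sum>x'\<in>UNIV. \<Sum>i\<in>UNIV. \<Sum>j\<in>UNIV. if j = y 1 then if i = y 0 then if x' = x then g x' i j else 0 else 0 else 0)"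
        unfolding Pair by (intro sum.cong refl) (auto simp: indicator_def ind)
      then show ?thesis by (simp add: Pair)
    qed
    have it: "integrable \<pi> (\<lambda>z. g x i j * indicator (block 2 (e x i j)) z)" for x i j
      by (intro integrable_mult_right integrable_real_indicator bs) (simp add: P.emeasure_eq_measure)
    have ig: "(\<integral>z. g x i j * indicator (block 2 (e x i j)) z \<partial>\<pi>) = g x i j * (w x i j * \<nu> j)" for x i j
      by (simp add: bs sp_pi e)
    show ?thesis
      unfolding ge
      by (simp only: ig Bochner_Integration.integral_sum[OF it]
        Bochner_Integration.integral_sum[OF Bochner_Integration.integrable_sum[OF it]]
        Bochner_Integration.integral_sum[OF Bochner_Integration.integrable_sum[OF Bochner_Integration.integrable_sum[OF it]]])
  qed
  have st': "(\<Sum>x\<in>UNIV. \<Sum>j\<in>UNIV. w x i j * \<nu> j) = \<nu> i" for i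
    unfolding st[of i, symmetric] Q_def by (subst sum.swap) (simp add: sum_distrib_right)
  show thesis by (rule that[OF invp \<nu> st' int jac])
qed

section \<open>The Perron eigenvalue of a positive matrix of size two\<close>

lemma cauchy_schwarz_sqrt:
  fixes a b c d :: real
  assumes "0 \<le> a" "0 \<le> b" "0 \<le> c" "0 \<le> d"
  shows "sqrt (a * b) + sqrt (c * d) \<le> sqrt ((a + c) * (b + d))"
    and "a * d \<noteq> b * c \<Longrightarrow> sqrt (a * b) + sqrt (c * d) < sqrt ((a + c) * (b + d))"
proof -
  have e: "(a + c) * (b + d) = (sqrt (a * b) + sqrt (c * d))\<^sup>2 + (sqrt (a * d) - sqrt (b * c))\<^sup>2"
    using assms by (simp add: power2_sum power2_diff algebra_simps real_sqrt_mult)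
  show "sqrt (a * b) + sqrt (c * d) \<le> sqrt ((a + c) * (b + d))"
    unfolding e using assms by (intro real_le_rsqrt) simp
  assume "a * d \<noteq> b * c"
  then have "(sqrt (a * d) - sqrt (b * c))\<^sup>2 > 0" by (simp add: real_sqrt_eq_iff)
  then show "sqrt (a * b) + sqrt (c * d) < sqrt ((a + c) * (b + d))"
    unfolding e by (intro real_less_rsqrt) simp
qed

text \<open>
  The larger eigenvalue of a \<open>2 \<times> 2\<close> matrix, as a root of the characteristic polynomial; it is used for
  matrices with positive entries, where the discriminant is positive.
\<close>

definition perron :: "real^2^2 \<Rightarrow> real" where
  "perron M = (trace M + sqrt ((trace M)\<^sup>2 - 4 * det M)) / 2"

lemma perron_disc:
  assumes "\<And>i j. 0 < M $ i $ j"
  shows "(trace M)\<^sup>2 - 4 * det (M :: real^2^2) > 0"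
proof -
  have "(trace M)\<^sup>2 - 4 * det M = (M$1$1 - M$2$2)\<^sup>2 + 4 * (M$1$2 * M$2$1)"
    by (simp add: trace_def sum_2 det_2 algebra_simps power2_eq_square)
  moreover have "M$1$2 * M$2$1 > 0" using assms by simp
  ultimately show ?thesis by (smt (verit) zero_le_power2)
qed

lemma perron_char:
  assumes "\<And>i j. 0 < M $ i $ j"
  shows "(perron M)\<^sup>2 - trace M * perron M + det (M :: real^2^2) = 0"
proof -
  have "(sqrt ((trace M)\<^sup>2 - 4 * det M))\<^sup>2 = (trace M)\<^sup>2 - 4 * det M"
    using perron_disc[OF assms] by (intro real_sqrt_pow2) simp
  then show ?thesis by (simp add: perron_def power2_eq_square field_simps)
qed

lemma perron_gt_diagonal:
  assumes pos: "\<And>i j. 0 < (M :: real^2^2) $ i $ j"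
  shows "M $ i $ i < perron M"
proof -
  let ?R = "sqrt ((trace M)\<^sup>2 - 4 * det M)"
  have "(trace M)\<^sup>2 - 4 * det M = (M$1$1 - M$2$2)\<^sup>2 + 4 * (M$1$2 * M$2$1)"
    by (simp add: trace_def sum_2 det_2 algebra_simps power2_eq_square)
  moreover have "M$1$2 * M$2$1 > 0" using pos by simp
  ultimately have "\<bar>M$1$1 - M$2$2\<bar> < ?R" by (intro real_less_rsqrt) simp
  moreover have "i = 1 \<or> i = 2" by (rule exhaust_2)
  ultimately show ?thesis by (auto simp: perron_def trace_def sum_2)
qed

lemma perron_eigenvector:
  assumes pos: "\<And>i j. 0 < (M :: real^2^2) $ i $ j"
  obtains h :: "2 \<Rightarrow> real" where "\<And>i. 0 < h i" "\<And>j. (\<Sum>i\<in>UNIV. h i * M $ i $ j) = perron M * h j"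
proof
  let ?h = "\<lambda>i::2. if i = 1 then M$2$1 else perron M - M$1$1"
  show "0 < ?h i" for i using pos perron_gt_diagonal[OF pos, of 1] by simp
  show "(\<Sum>i\<in>UNIV. ?h i * M $ i $ j) = perron M * ?h j" for j
  proof -
    have "j = 1 \<or> j = 2" by (rule exhaust_2)
    then show ?thesis using perron_char[OF pos]
      by (auto simp: sum_2 trace_def det_2 algebra_simps power2_eq_square)
  qed
qed

text \<open>
  A positive right eigenvector \<open>g\<close>, stated as a pairing identity against arbitrary left vectors \<open>v\<close>.
\<close>

lemma perron_right_pairing:
  assumes pos: "\<And>i j. 0 < (M :: real^2^2) $ i $ j"
  obtains g :: "2 \<Rightarrow> real" where "\<And>j. 0 < g j"
    "\<And>v. (\<Sum>j\<in>UNIV. g j * (\<Sum>i\<in>UNIV. v i * M $ i $ j)) = perron M * (\<Sum>i\<in>UNIV. g i * v i)"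
proof -
  define N where "N = transpose M"
  have posN: "\<And>i j. 0 < N $ i $ j" using assms by (simp add: N_def transpose_def)
  have "trace N = trace M" by (simp add: N_def trace_def transpose_def)
  then have pN: "perron N = perron M" by (simp add: perron_def N_def)
  obtain g where g: "\<And>i. 0 < g i" "\<And>j. (\<Sum>i\<in>UNIV. g i * N $ i $ j) = perron N * g j"
    by (rule perron_eigenvector[OF posN], rule that)
  have "(\<Sum>j\<in>UNIV. g j * (\<Sum>i\<in>UNIV. v i * M $ i $ j)) = (\<Sum>i\<in>UNIV. v i * (\<Sum>j\<in>UNIV. g j * N $ j $ i))" for v
    by (simp add: sum_2 N_def transpose_def algebra_simps)
  also have "\<dots> v = perron M * (\<Sum>i\<in>UNIV. g i * v i)" for v
    unfolding g(2) pN by (simp add: sum_distrib_left mult_ac)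
  finally show thesis using g(1) that by blast
qed

lemma perron_less:
  fixes M :: "real^2^2" and v :: "2 \<Rightarrow> real"
  assumes pos: "\<And>i j. 0 < M $ i $ j" and v: "\<And>i. 0 < v i"
    and less: "\<And>j. (\<Sum>i\<in>UNIV. v i * M $ i $ j) < r * v j"
  shows "perron M < r"
proof -
  obtain g where g: "\<And>j. 0 < g j"
    "\<And>v. (\<Sum>j\<in>UNIV. g j * (\<Sum>i\<in>UNIV. v i * M $ i $ j)) = perron M * (\<Sum>i\<in>UNIV. g i * v i)"
    by (rule perron_right_pairing[OF pos], rule that)
  have "perron M * (\<Sum>i\<in>UNIV. g i * v i) < (\<Sum>j\<in>UNIV. g j * (r * v j))"
    unfolding g(2)[symmetric] using less g(1) by (intro sum_strict_mono) auto
  also have "\<dots> = r * (\<Sum>i\<in>UNIV. g i * v i)"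
    by (simp add: sum_distrib_left mult_ac)
  finally show ?thesis using sum_pos[of UNIV "\<lambda>i. g i * v i"] v g(1) by simp
qed

lemma perron_unique:
  fixes M :: "real^2^2" and h :: "2 \<Rightarrow> real"
  assumes pos: "\<And>i j. 0 < M $ i $ j" and h: "\<And>i. 0 < h i"
    and eig: "\<And>j. (\<Sum>i\<in>UNIV. h i * M $ i $ j) = r * h j"
  shows "perron M = r"
proof -
  obtain g where g: "\<And>j. 0 < g j"
    "\<And>v. (\<Sum>j\<in>UNIV. g j * (\<Sum>i\<in>UNIV. v i * M $ i $ j)) = perron M * (\<Sum>i\<in>UNIV. g i * v i)"
    by (rule perron_right_pairing[OF pos], rule that)
  have "perron M * (\<Sum>i\<in>UNIV. g i * h i) = r * (\<Sum>i\<in>UNIV. g i * h i)"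
    unfolding g(2)[symmetric] eig by (simp add: sum_distrib_left mult_ac)
  moreover have "0 < (\<Sum>i\<in>UNIV. g i * h i)" using h g(1) by (intro sum_pos) auto
  ultimately show ?thesis by simp
qed

text \<open>
  With left eigenvectors \<open>h\<close> and \<open>g\<close> at \<open>s\<close> and \<open>t\<close>, the vector with entries \<open>sqrt (h\<^sub>i g\<^sub>i)\<close> is a strict
  subsolution at the geometric mean. Strictness holds because both matrices contribute to every entry in
  different proportions at \<open>s\<close> and \<open>t\<close>.
\<close>

lemma perron_log_convex_strict:
  fixes A B :: "real^2^2"
  assumes A: "\<And>i j. 0 < A $ i $ j" and B: "\<And>i j. 0 < B $ i $ j"
    and s: "0 < s" and t: "0 < t" and st: "s \<noteq> t"
  shows "perron (A + sqrt (s * t) *\<^sub>R B) < sqrt (perron (A + s *\<^sub>R B) * perron (A + t *\<^sub>R B))"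
proof -
  have pos: "0 < (A + r *\<^sub>R B) $ i $ j" if "0 < r" for r i j using A B that by (simp add: add_pos_pos)
  obtain h where h: "\<And>i. 0 < h i" "\<And>j. (\<Sum>i\<in>UNIV. h i * (A + s *\<^sub>R B) $ i $ j) = perron (A + s *\<^sub>R B) * h j"
    by (rule perron_eigenvector[OF pos[OF s]], rule that)
  obtain g where g: "\<And>i. 0 < g i" "\<And>j. (\<Sum>i\<in>UNIV. g i * (A + t *\<^sub>R B) $ i $ j) = perron (A + t *\<^sub>R B) * g j"
    by (rule perron_eigenvector[OF pos[OF t]], rule that)
  show ?thesis
  proof (rule perron_less[where v = "\<lambda>i. sqrt (h i * g i)"])
    show "0 < (A + sqrt (s * t) *\<^sub>R B) $ i $ j" for i j using s t by (intro pos) simp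
    show "0 < sqrt (h i * g i)" for i using h g by simp
    fix j
    have entry: "sqrt (h i * g i) * (A + sqrt (s * t) *\<^sub>R B) $ i $ j
        < sqrt ((h i * (A + s *\<^sub>R B) $ i $ j) * (g i * (A + t *\<^sub>R B) $ i $ j))" for i
    proof -
      let ?a = "h i * A $ i $ j" and ?b = "g i * A $ i $ j" and ?c = "h i * (s * B $ i $ j)" and ?d = "g i * (t * B $ i $ j)"
      have p: "0 < ?a" "0 < ?b" "0 < ?c" "0 < ?d" using h g A B s t by simp_all
      have "h i * g i * A $ i $ j * B $ i $ j \<noteq> 0" using h(1)[of i] g(1)[of i] A[of i j] B[of i j] by auto
      then have "?a * ?d \<noteq> ?b * ?c" using st by (auto simp: algebra_simps)
      then have "sqrt (?a * ?b) + sqrt (?c * ?d) < sqrt ((?a + ?c) * (?b + ?d))"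
        using p by (intro cauchy_schwarz_sqrt(2)) simp_all
      moreover have "sqrt (?a * ?b) = sqrt (h i * g i) * A $ i $ j"
        using less_imp_le[OF A[of i j]] by (simp add: real_sqrt_mult)
      moreover have "sqrt (?c * ?d) = sqrt (h i * g i) * (sqrt (s * t) * B $ i $ j)"
        using less_imp_le[OF B[of i j]] by (simp add: real_sqrt_mult)
      ultimately show ?thesis by (simp add: algebra_simps)
    qed
    have "(\<Sum>i\<in>UNIV. sqrt (h i * g i) * (A + sqrt (s * t) *\<^sub>R B) $ i $ j)
      < (\<Sum>i\<in>UNIV. sqrt ((h i * (A + s *\<^sub>R B) $ i $ j) * (g i * (A + t *\<^sub>R B) $ i $ j)))"
      using entry by (intro sum_strict_mono) auto
    also have "\<dots> \<le> sqrt ((\<Sum>i\<in>UNIV. h i * (A + s *\<^sub>R B) $ i $ j) * (\<Sum>i\<in>UNIV. g i * (A + t *\<^sub>R B) $ i $ j))"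
      unfolding sum_2 using h(1) g(1) pos[OF s] pos[OF t] by (intro cauchy_schwarz_sqrt(1)) (simp_all add: less_imp_le)
    also have "\<dots> = sqrt (perron (A + s *\<^sub>R B) * perron (A + t *\<^sub>R B)) * sqrt (h j * g j)"
      unfolding h(2) g(2) by (simp add: real_sqrt_mult)
    finally show "(\<Sum>i\<in>UNIV. sqrt (h i * g i) * (A + sqrt (s * t) *\<^sub>R B) $ i $ j)
      < sqrt (perron (A + s *\<^sub>R B) * perron (A + t *\<^sub>R B)) * sqrt (h j * g j)" .
  qed
qed

section \<open>The reduced dual problem\<close>

text \<open>
  The dual objective \<open>p \<phi>\<^sub>1 + (1 - p) \<phi>\<^sub>2\<close> at the admissible \<open>\<phi>\<close> with \<open>\<phi>\<^sub>1 - \<phi>\<^sub>2 = ln s\<close>.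
\<close>

definition dual_value :: "real \<Rightarrow> real^2^2 \<Rightarrow> real^2^2 \<Rightarrow> real \<Rightarrow> real" where
  "dual_value p A B s = ln (perron (A + s *\<^sub>R B)) - (1 - p) * ln s"

context
  fixes A B :: "real^2^2"
  assumes A: "\<And>i j. 0 < A $ i $ j" and B: "\<And>i j. 0 < B $ i $ j"
begin

lemma pencil_pos: "0 \<le> s \<Longrightarrow> 0 < (A + s *\<^sub>R B) $ i $ j"
  using A[of i j] B[of i j] by (simp add: add_pos_nonneg)

lemma perron_pencil_ge:
  assumes "0 \<le> s"
  shows "A $ 1 $ 1 \<le> perron (A + s *\<^sub>R B)" "s * B $ 1 $ 1 \<le> perron (A + s *\<^sub>R B)" "0 < perron (A + s *\<^sub>R B)"
proof -
  have *: "A $ 1 $ 1 + s * B $ 1 $ 1 < perron (A + s *\<^sub>R B)"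
    using perron_gt_diagonal[OF pencil_pos[OF assms], of 1] by simp
  moreover have "0 \<le> s * B $ 1 $ 1" "0 < A $ 1 $ 1" using assms A B by (simp_all add: less_imp_le)
  ultimately show "A $ 1 $ 1 \<le> perron (A + s *\<^sub>R B)" "s * B $ 1 $ 1 \<le> perron (A + s *\<^sub>R B)" "0 < perron (A + s *\<^sub>R B)"
    by linarith+
qed

lemma perron_pencil_derivative:
  assumes s: "0 < s"
  shows "\<exists>l. ((\<lambda>s. perron (A + s *\<^sub>R B)) has_real_derivative l) (at s)"
proof -
  have *: "(trace (A + s *\<^sub>R B))\<^sup>2 - 4 * det (A + s *\<^sub>R B) > 0"
    using s by (intro perron_disc pencil_pos) simp
  show ?thesis
    using * unfolding perron_def trace_def sum_2 det_2
    by (intro exI) (auto intro!: derivative_eq_intros)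
qed

lemma dual_value_continuous: "continuous_on {0<..} (dual_value p A B)"
proof (intro continuous_at_imp_continuous_on ballI)
  fix s :: real assume s: "s \<in> {0<..}"
  then have "isCont (\<lambda>s. perron (A + s *\<^sub>R B)) s"
    using perron_pencil_derivative[of s] DERIV_isCont by auto
  then show "isCont (dual_value p A B) s"
    using s perron_pencil_ge(3)[of s] unfolding dual_value_def[abs_def]
    by (intro continuous_intros) auto
qed

lemma dual_value_attains_min:
  assumes p: "0 < p" "p < 1"
  shows "\<exists>s>0. \<forall>t>0. dual_value p A B s \<le> dual_value p A B t"
proof -
  let ?g = "dual_value p A B"
  \<comment> \<open>chosen so that outside \<open>[exp (- R), exp R]\<close> one of the bounds \<open>perron \<ge> A\<^sub>1\<^sub>1\<close> and
    \<open>perron \<ge> s B\<^sub>1\<^sub>1\<close> makes the objective at least its value at \<open>1\<close>\<close>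
  define R where "R = max ((?g 1 - ln (B $ 1 $ 1)) / p) (max 0 ((?g 1 - ln (A $ 1 $ 1)) / (1 - p)))"
  have R0: "0 \<le> R" by (simp add: R_def)
  have "\<exists>s\<in>{exp (- R)..exp R}. \<forall>t\<in>{exp (- R)..exp R}. ?g s \<le> ?g t"
    using R0 by (intro continuous_attains_inf continuous_on_subset[OF dual_value_continuous])
       (auto intro: less_le_trans[OF exp_gt_zero])
  then obtain s where s: "s \<in> {exp (- R)..exp R}" "\<And>t. t \<in> {exp (- R)..exp R} \<Longrightarrow> ?g s \<le> ?g t" by blast
  have s1: "?g s \<le> ?g 1" using s(2)[of 1] R0 by simp
  have "?g s \<le> ?g t" if t: "0 < t" for t
  proof -
    consider "t < exp (- R)" | "t \<in> {exp (- R)..exp R}" | "exp R < t" by force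
    then show ?thesis
    proof cases
      case 1
      then have "ln t < - R" using t by (metis ln_exp ln_less_cancel_iff exp_gt_zero)
      then have "(1 - p) * R \<le> (1 - p) * - ln t" using p by (intro mult_left_mono) auto
      moreover have "(?g 1 - ln (A $ 1 $ 1)) / (1 - p) \<le> R" by (simp add: R_def)
      then have "?g 1 - ln (A $ 1 $ 1) \<le> (1 - p) * R" using p by (simp add: pos_divide_le_eq mult.commute)
      moreover have "ln (A $ 1 $ 1) \<le> ln (perron (A + t *\<^sub>R B))"
        using perron_pencil_ge[of t] t A by simp
      ultimately show ?thesis using s1 by (simp add: dual_value_def)
    next
      case 2
      then show ?thesis by (rule s(2))
    next
      case 3
      then have "R < ln t" using t by (metis ln_exp ln_less_cancel_iff exp_gt_zero)
      then have "p * R \<le> p * ln t" using p by (intro mult_left_mono) auto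
      moreover have "(?g 1 - ln (B $ 1 $ 1)) / p \<le> R" by (simp add: R_def)
      then have "?g 1 - ln (B $ 1 $ 1) \<le> p * R" using p by (simp add: pos_divide_le_eq mult.commute)
      moreover have "ln (t * B $ 1 $ 1) \<le> ln (perron (A + t *\<^sub>R B))"
        using perron_pencil_ge[of t] t B[of 1 1] by simp
      then have "ln t + ln (B $ 1 $ 1) \<le> ln (perron (A + t *\<^sub>R B))"
        using t B[of 1 1] by (simp add: ln_mult)
      ultimately show ?thesis using s1 by (simp add: dual_value_def algebra_simps)
    qed
  qed
  moreover have "0 < s" using s(1) by (auto intro: less_le_trans[OF exp_gt_zero])
  ultimately show ?thesis by blast
qed

lemma dual_value_min_unique:
  assumes s: "0 < s" "\<And>r. 0 < r \<Longrightarrow> dual_value p A B s \<le> dual_value p A B r"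
    and t: "0 < t" "dual_value p A B t \<le> dual_value p A B s"
  shows "t = s"
proof (rule ccontr)
  assume "t \<noteq> s"
  then have "perron (A + sqrt (s * t) *\<^sub>R B) < sqrt (perron (A + s *\<^sub>R B) * perron (A + t *\<^sub>R B))"
    using s t by (intro perron_log_convex_strict A B) auto
  moreover have "0 < perron (A + sqrt (s * t) *\<^sub>R B)" "0 < perron (A + s *\<^sub>R B)" "0 < perron (A + t *\<^sub>R B)"
    using s t by (auto intro: perron_pencil_ge(3))
  ultimately have "ln (perron (A + sqrt (s * t) *\<^sub>R B)) < ln (sqrt (perron (A + s *\<^sub>R B) * perron (A + t *\<^sub>R B)))"
    by (subst ln_less_cancel_iff) simp_all
  also have "\<dots> = (ln (perron (A + s *\<^sub>R B)) + ln (perron (A + t *\<^sub>R B))) / 2"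
    using perron_pencil_ge(3)[of s] perron_pencil_ge(3)[of t] s t by (simp add: ln_sqrt ln_mult)
  finally have "ln (perron (A + sqrt (s * t) *\<^sub>R B)) < (ln (perron (A + s *\<^sub>R B)) + ln (perron (A + t *\<^sub>R B))) / 2" .
  moreover have "ln (sqrt (s * t)) = (ln s + ln t) / 2" using s t by (simp add: ln_sqrt ln_mult)
  ultimately have "dual_value p A B (sqrt (s * t)) < (dual_value p A B s + dual_value p A B t) / 2"
    by (simp add: dual_value_def algebra_simps)
  moreover have "dual_value p A B s \<le> dual_value p A B (sqrt (s * t))" using s t by simp
  ultimately show False using t by simp
qed

text \<open>
  Vanishing of the derivative gives \<open>s r' = (1 - p) r\<close>; inserting this into the differentiated characteristic
  equation eliminates \<open>r'\<close>.
\<close>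

lemma dual_value_stationary:
  assumes s: "0 < s" "\<And>r. 0 < r \<Longrightarrow> dual_value p A B s \<le> dual_value p A B r"
    and r: "r = perron (A + s *\<^sub>R B)"
    and g: "\<And>s. det (A + s *\<^sub>R B) = det A + \<gamma> * s + det B * s\<^sup>2"
  shows "(1 - p) * (2 * r\<^sup>2 - (trace A + s * trace B) * r) = s * (trace B * r - (\<gamma> + 2 * det B * s))"
proof -
  obtain l where l: "((\<lambda>s. perron (A + s *\<^sub>R B)) has_real_derivative l) (at s)"
    using perron_pencil_derivative[OF s(1)] by blast
  have r0: "0 < r" using perron_pencil_ge(3) s r by simp
  have "(dual_value p A B has_real_derivative l / r - (1 - p) / s) (at s)"
    unfolding dual_value_def[abs_def] using r0 s(1) r
    by (auto intro!: derivative_eq_intros l)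
  then have "l / r - (1 - p) / s = 0"
    by (rule DERIV_local_min[where d = s]) (use s in \<open>auto simp: abs_if split: if_splits\<close>)
  then have ls: "l * s = (1 - p) * r" using r0 s(1) by (simp add: field_simps)
  have tr: "trace (A + s *\<^sub>R B) = trace A + s * trace B" for s
    by (simp add: trace_def sum_2 algebra_simps)
  let ?P = "\<lambda>s. (perron (A + s *\<^sub>R B))\<^sup>2 - (trace A + s * trace B) * perron (A + s *\<^sub>R B) + (det A + \<gamma> * s + det B * s\<^sup>2)"
  have "(?P has_real_derivative 2 * r * l - (trace B * r + (trace A + s * trace B) * l) + (\<gamma> + 2 * det B * s)) (at s)"
    unfolding r by (auto intro!: derivative_eq_intros l simp: algebra_simps)
  moreover have "(?P has_real_derivative 0) (at s)"
  proof (rule has_field_derivative_transform_within_open)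
    show "((\<lambda>_. 0) has_real_derivative 0) (at s)" by simp
    show "open {0::real<..}" "s \<in> {0<..}" using s by auto
    show "0 = ?P t" if "t \<in> {0<..}" for t
      using perron_char[of "A + t *\<^sub>R B"] pencil_pos[of t] that by (simp add: tr g)
  qed
  ultimately have "2 * r * l - (trace B * r + (trace A + s * trace B) * l) + (\<gamma> + 2 * det B * s) = 0"
    using DERIV_unique by blast
  then have "s * (2 * r * l - (trace B * r + (trace A + s * trace B) * l) + (\<gamma> + 2 * det B * s)) = 0" by simp
  then have "(l * s) * (2 * r - (trace A + s * trace B)) = s * (trace B * r - (\<gamma> + 2 * det B * s))"
    by (simp add: algebra_simps)
  then show ?thesis unfolding ls by (simp add: algebra_simps power2_eq_square)
qed

end

section \<open>Intersections of the two conics\<close>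

lemma card_roots_le:
  fixes q :: "real poly"
  assumes "q \<noteq> 0" "degree q \<le> n" "\<And>x. x \<in> A \<Longrightarrow> poly q x = 0"
  shows "finite A \<and> card A \<le> n"
proof -
  have "A \<subseteq> {x. poly q x = 0}" using assms by auto
  moreover have "finite {x. poly q x = 0}" "card {x. poly q x = 0} \<le> degree q"
    using assms poly_roots_finite card_poly_roots_bound by blast+
  ultimately show ?thesis using assms(2) by (meson card_mono finite_subset le_trans)
qed

lemma degree_mult_bound:
  fixes q r :: "real poly"
  shows "degree q \<le> m \<Longrightarrow> degree r \<le> n \<Longrightarrow> degree (q * r) \<le> m + n"
  by (rule order_trans[OF degree_mult_le]) simp

text \<open>
  The first conic does not pass through the origin, and the slope \<open>s = z\<^sub>2 / z\<^sub>1\<close> is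
  defined at every intersection point. Away from the origin, on the line of slope \<open>s\<close> the second conic reads \<open>l s + z\<^sub>1 q s = 0\<close>. If \<open>q\<close> does not vanish at the zero \<open>s0\<close> of \<open>l\<close>, then \<open>z\<^sub>1\<close> is
  determined by \<open>s\<close>, and \<open>s\<close> is a root of the resultant \<open>R\<close>. Otherwise \<open>q = l m\<close>, the second conic is the
  union of the line \<open>s = s0\<close> and the line \<open>1 + z\<^sub>1 m s = 0\<close>, and each of them meets the first conic in at most two points.
  The discriminant conditions say that the first conic has no double point on either coordinate axis; they
  exclude \<open>z\<^sub>1 = 0\<close> and prevent the first conic from containing the second line.
\<close>

lemma conics_card_le:
  fixes a b \<gamma> \<delta> \<epsilon> p :: real
  assumes p: "0 < p" "p < 1" and neg: "\<delta> < 0" "\<epsilon> < 0"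
    and disc: "4 * a < \<delta>\<^sup>2" "4 * b < \<epsilon>\<^sup>2"
    and S: "S = {(z1, z2).
        a * z1\<^sup>2 + b * z2\<^sup>2 + \<gamma> * z1 * z2 + \<delta> * z1 + \<epsilon> * z2 + 1 = 0 \<and>
        2 * b * p * z2\<^sup>2 - 2 * a * (1 - p) * z1\<^sup>2 + \<gamma> * (2 * p - 1) * z1 * z2
          + \<epsilon> * p * z2 - \<delta> * (1 - p) * z1 = 0}"
  shows "finite S \<and> card S \<le> 4"
proof -
  define l where "l s = \<epsilon> * p * s - \<delta> * (1 - p)" for s
  define q where "q s = 2 * b * p * s\<^sup>2 + \<gamma> * (2 * p - 1) * s - 2 * a * (1 - p)" for s
  have nz: "z1 \<noteq> 0" if "(z1, z2) \<in> S" for z1 z2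
  proof
    assume "z1 = 0"
    then have e: "b * z2\<^sup>2 + \<epsilon> * z2 + 1 = 0" "p * z2 * (2 * b * z2 + \<epsilon>) = 0"
      using that by (simp_all add: S algebra_simps power2_eq_square)
    then have "z2 \<noteq> 0" by auto
    with e(2) p have eps: "\<epsilon> = - (2 * b * z2)" by auto
    then have "b * z2\<^sup>2 = 1" using e(1) by (simp add: power2_eq_square algebra_simps)
    moreover have "\<epsilon>\<^sup>2 = 4 * b * (b * z2\<^sup>2)" unfolding eps by (simp add: power2_eq_square)
    ultimately show False using disc(2) by simp
  qed
  have F: "1 + z1 * (\<delta> + \<epsilon> * s) + z1\<^sup>2 * (a + \<gamma> * s + b * s\<^sup>2) = 0"
    and G: "l s + z1 * q s = 0" if "(z1, z2) \<in> S" "s = z2 / z1" for z1 z2 s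
  proof -
    have z2: "z2 = s * z1" using that nz by simp
    show "1 + z1 * (\<delta> + \<epsilon> * s) + z1\<^sup>2 * (a + \<gamma> * s + b * s\<^sup>2) = 0"
      using that(1) unfolding S z2 by (simp add: algebra_simps power2_eq_square)
    have "z1 * (l s + z1 * q s) = 0"
      using that(1) unfolding S z2 l_def q_def by (simp add: algebra_simps power2_eq_square)
    then show "l s + z1 * q s = 0" using nz that by simp
  qed
  define s0 where "s0 = \<delta> * (1 - p) / (\<epsilon> * p)"
  have s0: "l s = \<epsilon> * p * (s - s0)" for s
    using p neg by (simp add: l_def s0_def field_simps)
  have l0: "l s = 0 \<longleftrightarrow> s = s0" for s using p neg by (simp add: s0)
  show ?thesis
  proof (cases "q s0 = 0")
    case False
    define lp where "lp = [: - \<delta> * (1 - p), \<epsilon> * p :]"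
    define qp where "qp = [: - 2 * a * (1 - p), \<gamma> * (2 * p - 1), 2 * b * p :]"
    \<comment> \<open>the resultant in \<open>z\<^sub>1\<close> of \<open>1 + z\<^sub>1 L + z\<^sub>1\<^sup>2 D\<close> and \<open>l + z\<^sub>1 q\<close>; at \<open>s0\<close> it equals \<open>q s0\<close> squared\<close>
    define R where "R = [: a, \<gamma>, b :] * (lp * lp) - [: \<delta>, \<epsilon> :] * lp * qp + qp * qp"
    have R: "poly R s = (a + \<gamma> * s + b * s\<^sup>2) * (l s)\<^sup>2 - (\<delta> + \<epsilon> * s) * l s * q s + (q s)\<^sup>2" for s
      by (simp add: R_def lp_def qp_def l_def q_def algebra_simps power2_eq_square)
    have "poly R s0 \<noteq> 0" using False l0[of s0] by (simp add: R)
    then have "R \<noteq> 0" by auto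
    moreover have "degree R \<le> 4"
    proof -
      have "degree lp \<le> 1" "degree qp \<le> 2" "degree [: \<delta>, \<epsilon> :] \<le> 1" "degree [: a, \<gamma>, b :] \<le> 2"
        by (simp_all add: lp_def qp_def)
      then have "degree ([: a, \<gamma>, b :] * (lp * lp)) \<le> 2 + (1 + 1)" "degree ([: \<delta>, \<epsilon> :] * lp * qp) \<le> 1 + 1 + 2"
        "degree (qp * qp) \<le> 2 + 2"
        by (safe intro!: degree_mult_bound)
      then show ?thesis unfolding R_def by (intro degree_add_le degree_diff_le) simp_all
    qed
    moreover have "poly R s = 0" if sS: "s \<in> (\<lambda>(z1, z2). z2 / z1) ` S" for s
    proof -
      obtain z1 z2 where z: "(z1, z2) \<in> S" "s = z2 / z1" using sS by auto
      have "l s = - z1 * q s" using G[OF z] by simp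
      then have "poly R s = (q s)\<^sup>2 * (1 + z1 * (\<delta> + \<epsilon> * s) + z1\<^sup>2 * (a + \<gamma> * s + b * s\<^sup>2))"
        unfolding R by (simp add: algebra_simps power2_eq_square)
      then show ?thesis using F[OF z] by simp
    qed
    ultimately have card: "finite ((\<lambda>(z1, z2). z2 / z1) ` S) \<and> card ((\<lambda>(z1, z2). z2 / z1) ` S) \<le> 4"
      by (rule card_roots_le)
    have "inj_on (\<lambda>(z1, z2). z2 / z1) S"
    proof (rule inj_onI, clarify)
      fix z1 z2 w1 w2 assume z: "(z1, z2) \<in> S" and w: "(w1, w2) \<in> S" and e: "z2 / z1 = w2 / w1"
      define s where "s = z2 / z1"
      have "l s + z1 * q s = 0" "l s + w1 * q s = 0"
        using G[OF z] G[OF w] e by (auto simp: s_def)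
      moreover from this have "q s \<noteq> 0" using False l0 by auto
      ultimately have "z1 = w1" by (metis add_left_cancel mult_right_cancel)
      then show "z1 = w1 \<and> z2 = w2" using e nz[OF w] by simp
    qed
    with card show ?thesis using card_image finite_image_iff by metis
  next
    case True
    define m where "m s = 2 * a / \<delta> + 2 * b / \<epsilon> * s" for s
    have qlm: "q s = l s * m s" for s
    proof -
      have s0': "s0 * (\<epsilon> * p) = \<delta> * (1 - p)" using p neg by (simp add: s0_def)
      have "q s0 * (\<epsilon> * p)\<^sup>2 = 2 * b * p * (s0 * (\<epsilon> * p))\<^sup>2
          + \<gamma> * (2 * p - 1) * (s0 * (\<epsilon> * p)) * (\<epsilon> * p) - 2 * a * (1 - p) * (\<epsilon> * p)\<^sup>2"
        by (simp add: q_def algebra_simps power2_eq_square)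
      also have "\<dots> = p * (1 - p) * (2 * b * \<delta>\<^sup>2 * (1 - p) + \<gamma> * (2 * p - 1) * \<delta> * \<epsilon> - 2 * a * \<epsilon>\<^sup>2 * p)"
        unfolding s0' by (simp add: algebra_simps power2_eq_square)
      finally have "p * (1 - p) * (2 * b * \<delta>\<^sup>2 * (1 - p) + \<gamma> * (2 * p - 1) * \<delta> * \<epsilon> - 2 * a * \<epsilon>\<^sup>2 * p) = 0"
        using True by simp
      then have e: "\<gamma> * (2 * p - 1) * \<delta> * \<epsilon> = 2 * a * \<epsilon>\<^sup>2 * p - 2 * b * \<delta>\<^sup>2 * (1 - p)"
        using p by simp
      have "l s * m s * (\<delta> * \<epsilon>) = (2 * b * p * s\<^sup>2 - 2 * a * (1 - p)) * (\<delta> * \<epsilon>)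
          + (2 * a * \<epsilon>\<^sup>2 * p - 2 * b * \<delta>\<^sup>2 * (1 - p)) * s"
        using neg by (simp add: l_def m_def field_simps power2_eq_square)
      also have "\<dots> = q s * (\<delta> * \<epsilon>)"
        unfolding e[symmetric] by (simp add: q_def algebra_simps power2_eq_square)
      finally show ?thesis using neg by simp
    qed
    define S1 where "S1 = {z \<in> S. snd z / fst z = s0}"
    define S2 where "S2 = {z \<in> S. snd z / fst z \<noteq> s0}"
    have "finite S1 \<and> card S1 \<le> 2"
    proof -
      have "finite (fst ` S1) \<and> card (fst ` S1) \<le> 2"
      proof (rule card_roots_le[of "[: 1, \<delta> + \<epsilon> * s0, a + \<gamma> * s0 + b * s0\<^sup>2 :]"])
        fix t assume "t \<in> fst ` S1"
        then obtain z2 where "(t, z2) \<in> S" "s0 = z2 / t" by (auto simp: S1_def)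
        from F[OF this] show "poly [: 1, \<delta> + \<epsilon> * s0, a + \<gamma> * s0 + b * s0\<^sup>2 :] t = 0"
          by (simp add: algebra_simps power2_eq_square)
      qed auto
      moreover have "inj_on fst S1"
      proof (rule inj_onI)
        fix z w assume "z \<in> S1" "w \<in> S1" and e: "fst z = fst w"
        moreover from \<open>z \<in> S1\<close> have "(fst z, snd z) \<in> S" by (simp add: S1_def)
        ultimately have "snd z / fst z = snd w / fst w" "fst z \<noteq> 0" using nz by (auto simp: S1_def)
        then show "z = w" using e by (simp add: prod_eq_iff)
      qed
      ultimately show ?thesis using card_image finite_image_iff by metis
    qed
    moreover have "finite S2 \<and> card S2 \<le> 2"
    proof -
      have m1: "1 + z1 * m s = 0" if "(z1, z2) \<in> S2" "s = z2 / z1" for z1 z2 s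
      proof -
        have "l s * (1 + z1 * m s) = 0" using G[of z1 z2 s] that by (simp add: S2_def qlm algebra_simps)
        then show ?thesis using that l0[of s] by (simp add: S2_def)
      qed
      define Q where "Q = [: a, \<gamma>, b :] - [: \<delta>, \<epsilon> :] * [: 2 * a / \<delta>, 2 * b / \<epsilon> :] + [: 2 * a / \<delta>, 2 * b / \<epsilon> :] * [: 2 * a / \<delta>, 2 * b / \<epsilon> :]"
      have Qp: "poly Q s = (a + \<gamma> * s + b * s\<^sup>2) - (\<delta> + \<epsilon> * s) * m s + (m s)\<^sup>2" for s
        using neg by (simp add: Q_def m_def algebra_simps power2_eq_square add_divide_distrib)
      show ?thesis
      proof (cases "a = 0 \<and> b = 0")
        case True
        then have "S2 = {}" using m1 by (auto simp: m_def)
        then show ?thesis by simp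
      next
        case False
        have c0: "coeff Q 0 = a * (4 * a / \<delta>\<^sup>2 - 1)" 
          using neg by (simp add: Q_def power2_eq_square field_simps)
        have c2: "coeff Q 2 = b * (4 * b / \<epsilon>\<^sup>2 - 1)" 
          using neg by (simp add: Q_def power2_eq_square field_simps numeral_2_eq_2)
        have "4 * a / \<delta>\<^sup>2 < 1" "4 * b / \<epsilon>\<^sup>2 < 1" using disc neg by simp_all
        then have "4 * a / \<delta>\<^sup>2 - 1 \<noteq> 0" "4 * b / \<epsilon>\<^sup>2 - 1 \<noteq> 0" by linarith+
        then have "coeff Q 0 \<noteq> 0 \<or> coeff Q 2 \<noteq> 0" unfolding c0 c2 using False by auto
        then have "Q \<noteq> 0" by auto
        moreover have "degree Q \<le> 2"
        proof -
          have "degree [: \<delta>, \<epsilon> :] \<le> 1" "degree [: 2 * a / \<delta>, 2 * b / \<epsilon> :] \<le> 1" by simp_all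
          then have "degree ([: \<delta>, \<epsilon> :] * [: 2 * a / \<delta>, 2 * b / \<epsilon> :]) \<le> 1 + 1"
            "degree ([: 2 * a / \<delta>, 2 * b / \<epsilon> :] * [: 2 * a / \<delta>, 2 * b / \<epsilon> :]) \<le> 1 + 1"
            by (safe intro!: degree_mult_bound)
          moreover have "degree [: a, \<gamma>, b :] \<le> 2" by simp
          ultimately show ?thesis unfolding Q_def by (intro degree_add_le degree_diff_le) simp_all
        qed
        moreover have "poly Q s = 0" if sS: "s \<in> (\<lambda>z. snd z / fst z) ` S2" for s
        proof -
          obtain z1 z2 where z: "(z1, z2) \<in> S2" "s = z2 / z1" using sS by auto
          then have zS: "(z1, z2) \<in> S" by (simp add: S2_def)
          have "z1 * m s = -1" using m1[OF z] by simp
          then have "z1\<^sup>2 * poly Q s = 1 + z1 * (\<delta> + \<epsilon> * s) + z1\<^sup>2 * (a + \<gamma> * s + b * s\<^sup>2) - (1 + z1 * m s) * (1 + z1 * (\<delta> + \<epsilon> * s) - z1 * m s)"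
            unfolding Qp by (simp add: algebra_simps power2_eq_square)
          then show ?thesis using F[OF zS z(2)] m1[OF z] nz[OF zS] by simp
        qed
        ultimately have card: "finite ((\<lambda>z. snd z / fst z) ` S2) \<and> card ((\<lambda>z. snd z / fst z) ` S2) \<le> 2"
          by (rule card_roots_le)
        have "inj_on (\<lambda>z. snd z / fst z) S2"
        proof (rule inj_onI)
          fix z w assume z: "z \<in> S2" and w: "w \<in> S2" and e: "snd z / fst z = snd w / fst w"
          define s where "s = snd z / fst z"
          have "1 + fst z * m s = 0" "1 + fst w * m s = 0"
            using m1[of "fst z" "snd z" s] m1[of "fst w" "snd w" s] z w e by (auto simp: s_def)
          then have f: "fst z = fst w" by (metis add_left_cancel mult_right_cancel mult_zero_right add.right_neutral zero_neq_one)
          have "fst w \<noteq> 0" using w by (intro nz[of "fst w" "snd w"]) (simp add: S2_def)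
          then show "z = w" using e f by (simp add: prod_eq_iff)
        qed
        with card show ?thesis using card_image finite_image_iff by metis
      qed
    qed
    moreover have "S = S1 \<union> S2" by (auto simp: S1_def S2_def)
    ultimately show ?thesis using card_Un_le[of S1 S2] by simp
  qed
qed

section \<open>Pressure, admissibility and the dual minimizer\<close>

lemma pair_function_truncation:
  "(case truncation 2 z of (x, y) \<Rightarrow> f x (y 0) (y 1)) = (case z of (x, y) \<Rightarrow> f x (y 0) (y 1))"
  by (simp add: truncation_def split: prod.split)

lemma pair_function_integrable:
  assumes "\<pi> \<in> invariant_plans"
  shows "integrable \<pi> (\<lambda>(x, y). f x (y 0) (y 1) :: real)"
proof -
  interpret prob_space \<pi> by (rule invariant_plansD[OF assms])
  show ?thesis
    by (rule integral_truncation_function(1)[where n = 2, OF finite_measure_axioms sets_plan[OF assms]])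
      (rule pair_function_truncation)
qed

lemma integral_coordinate_shift:
  fixes q :: "2 \<Rightarrow> real"
  assumes "\<pi> \<in> invariant_plans"
  shows "(\<integral>(x, y). q (y 1) \<partial>\<pi>) = (\<integral>(x, y). q (y 0) \<partial>\<pi>)"
proof -
  have m: "(\<lambda>y. q (y k)) \<in> borel_measurable seq_space" for k
    unfolding seq_space_def by measurable
  have s: "shift \<in> measurable (marginal_seq \<pi>) seq_space"
    using shift_measurable measurable_cong_sets[OF sets_marginal_seq refl] by blast
  have e: "(\<integral>(x, y). q (y k) \<partial>\<pi>) = (\<integral>y. q (y k) \<partial>marginal_seq \<pi>)" for k
    unfolding marginal_seq_def by (subst integral_distr[OF snd_measurable_plan[OF assms] m]) (simp add: case_prod_beta')
  have "(\<integral>y. q (y 0) \<partial>marginal_seq \<pi>) = (\<integral>y. q (y 0) \<partial>distr (marginal_seq \<pi>) seq_space shift)"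
    by (simp add: invariant_plansD(3)[OF assms])
  also have "\<dots> = (\<integral>y. q (y 1) \<partial>marginal_seq \<pi>)"
    by (subst integral_distr[OF s m]) (simp add: shift_def)
  finally show ?thesis by (simp add: e)
qed

lemma integral_plus_entropy_le:
  assumes "\<pi> \<in> invariant_plans"
    and w: "\<And>x i j. 0 < w x i j" "\<And>j. (\<Sum>x\<in>UNIV. \<Sum>i\<in>UNIV. w x i j) = 1"
  shows "(\<integral>(x, y). f x (y 0) (y 1) \<partial>\<pi>) + plan_entropy \<pi> \<le> (\<integral>(x, y). f x (y 0) (y 1) - ln (w x (y 0) (y 1)) \<partial>\<pi>)"
proof -
  note int = pair_function_integrable[OF assms(1), unfolded case_prod_beta']
  have "(\<integral>(x, y). f x (y 0) (y 1) - ln (w x (y 0) (y 1)) \<partial>\<pi>) =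
      (\<integral>(x, y). f x (y 0) (y 1) \<partial>\<pi>) - (\<integral>(x, y). ln (w x (y 0) (y 1)) \<partial>\<pi>)"
    unfolding case_prod_beta' by (rule Bochner_Integration.integral_diff[OF int[of f] int[of "\<lambda>x i j. ln (w x i j)"]])
  then show ?thesis using gibbs_inequality[OF assms(1) w] by simp
qed

lemma pressure_eq_ln_eigenvalue:
  fixes f :: "2 \<Rightarrow> 2 \<Rightarrow> 2 \<Rightarrow> real"
  assumes h: "\<And>i. 0 < h i" and eig: "\<And>j. (\<Sum>i\<in>UNIV. h i * (\<Sum>x\<in>UNIV. exp (f x i j))) = r * h j"
  shows "pressure (\<lambda>(x, y). f x (y 0) (y 1)) = ereal (ln r)"
proof -
  have "0 < r * h 1" unfolding eig[symmetric] using h by (intro sum_pos mult_pos_pos) auto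
  then have r: "0 < r" using h[of 1] by (simp add: zero_less_mult_iff)
  define w where "w x i j = exp (f x i j) * h i / (r * h j)" for x i j
  have w: "0 < w x i j" for x i j using h r by (simp add: w_def)
  have w1: "(\<Sum>x\<in>UNIV. \<Sum>i\<in>UNIV. w x i j) = 1" for j
  proof -
    have "(\<Sum>x\<in>UNIV. \<Sum>i\<in>UNIV. w x i j) = (\<Sum>i\<in>UNIV. h i * (\<Sum>x\<in>UNIV. exp (f x i j))) / (r * h j)"
      by (simp add: w_def sum_2 add_divide_distrib algebra_simps)
    then show ?thesis using h[of j] r by (simp add: eig)
  qed
  have lnw: "f x i j - ln (w x i j) = ln r + ln (h j) - ln (h i)" for x i j
    using h[of i] h[of j] r by (simp add: w_def ln_mult ln_div)
  have val: "(\<integral>(x, y). f x (y 0) (y 1) - ln (w x (y 0) (y 1)) \<partial>\<pi>) = ln r" if "\<pi> \<in> invariant_plans" for \<pi>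
  proof -
    interpret prob_space \<pi> by (rule invariant_plansD[OF that])
    note int = pair_function_integrable[OF that, unfolded case_prod_beta']
    have "(\<integral>(x, y). f x (y 0) (y 1) - ln (w x (y 0) (y 1)) \<partial>\<pi>)
      = ln r + (\<integral>(x, y). ln (h (y 1)) \<partial>\<pi>) - (\<integral>(x, y). ln (h (y 0)) \<partial>\<pi>)"
      unfolding lnw case_prod_beta' using int[of "\<lambda>x i j. ln (h j)"] int[of "\<lambda>x i j. ln (h i)"]
      by (simp add: prob_space)
    then show ?thesis using integral_coordinate_shift[OF that, of "\<lambda>i. ln (h i)"] by simp
  qed
  have "ereal ((\<integral>z. (case z of (x, y) \<Rightarrow> f x (y 0) (y 1)) \<partial>\<pi>) + plan_entropy \<pi>) \<le> ereal (ln r)" if "\<pi> \<in> invariant_plans" for \<pi>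
    using integral_plus_entropy_le[where w = w and f = f, OF that w w1] val[OF that] by simp
  moreover have "\<exists>\<pi>\<in>invariant_plans. (\<integral>z. (case z of (x, y) \<Rightarrow> f x (y 0) (y 1)) \<partial>\<pi>) + plan_entropy \<pi> = ln r"
  proof -
    have "0 < (\<Sum>x\<in>UNIV. w x i j)" for i j using w by (intro sum_pos) auto
    then obtain \<pi> where \<pi>: "\<pi> \<in> invariant_plans" "\<And>x y. jac \<pi> (x, y) = w x (y 0) (y 1)"
      using gibbs_plan_exists[of w, OF less_imp_le[OF w] _ w1] by metis
    note int = pair_function_integrable[OF \<pi>(1), unfolded case_prod_beta']
    have "plan_entropy \<pi> = - (\<integral>(x, y). ln (w x (y 0) (y 1)) \<partial>\<pi>)"
      using \<pi>(2)[of "fst z" "snd z" for z] by (simp add: plan_entropy_def case_prod_beta')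
    then have "(\<integral>z. (case z of (x, y) \<Rightarrow> f x (y 0) (y 1)) \<partial>\<pi>) + plan_entropy \<pi>
        = (\<integral>(x, y). f x (y 0) (y 1) - ln (w x (y 0) (y 1)) \<partial>\<pi>)"
      using Bochner_Integration.integral_diff[OF int[of f] int[of "\<lambda>x i j. ln (w x i j)"]]
      by (simp add: case_prod_beta')
    then show ?thesis using val[OF \<pi>(1)] \<pi>(1) by auto
  qed
  ultimately show ?thesis
    unfolding pressure_def by (intro antisym SUP_least) (auto intro!: SUP_upper2)
qed

lemma integral_two_point_measure:
  assumes "0 \<le> p" "p \<le> 1"
  shows "(\<integral>x. \<phi> x \<partial>two_point_measure p) = p * \<phi> 1 + (1 - p) * (\<phi> 2 :: real)"
  using assms unfolding two_point_measure_def
  by (subst lebesgue_integral_point_measure_finite) (auto simp: sum_2)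

text \<open>
  The matrix of \<open>c - \<phi>\<close> is \<open>exp (- \<phi>\<^sub>1) (A + s B)\<close> with \<open>s = exp (\<phi>\<^sub>1 - \<phi>\<^sub>2)\<close>. Thus \<open>s > 0\<close> parametrizes the
  admissible functions.
\<close>

lemma admissible_iff:
  fixes A B :: "real^2^2"
  assumes A: "\<And>i j. A $ i $ j = exp (k 1 i j)" and B: "\<And>i j. B $ i $ j = exp (k 2 i j)"
    and c: "\<And>x y. c (x, y) = k x (y 0) (y 1)"
  shows "admissible c \<phi> \<longleftrightarrow> \<phi> 1 = ln (perron (A + exp (\<phi> 1 - \<phi> 2) *\<^sub>R B))"
proof -
  let ?M = "A + exp (\<phi> 1 - \<phi> 2) *\<^sub>R B"
  have posA: "0 < A $ i $ j" "0 < B $ i $ j" for i j by (simp_all add: A B)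
  have pos: "0 < ?M $ i $ j" for i j by (rule pencil_pos[OF posA]) simp
  obtain h where h: "\<And>i. 0 < h i" "\<And>j. (\<Sum>i\<in>UNIV. h i * ?M $ i $ j) = perron ?M * h j"
    by (rule perron_eigenvector[OF pos], rule that)
  have M: "(\<Sum>x\<in>UNIV. exp (k x i j - \<phi> x)) = exp (- \<phi> 1) * ?M $ i $ j" for i j
    by (simp add: sum_2 A B exp_diff exp_minus field_simps)
  have "pressure (\<lambda>(x, y). (\<lambda>x i j. k x i j - \<phi> x) x (y 0) (y 1)) = ereal (ln (exp (- \<phi> 1) * perron ?M))"
  proof (rule pressure_eq_ln_eigenvalue[OF h(1)])
    fix j
    have "(\<Sum>i\<in>UNIV. h i * (\<Sum>x\<in>UNIV. exp (k x i j - \<phi> x))) = exp (- \<phi> 1) * (\<Sum>i\<in>UNIV. h i * ?M $ i $ j)"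
      unfolding M by (simp only: sum_distrib_left mult_ac)
    then show "(\<Sum>i\<in>UNIV. h i * (\<Sum>x\<in>UNIV. exp (k x i j - \<phi> x))) = exp (- \<phi> 1) * perron ?M * h j"
      by (simp only: h(2) mult.assoc)
  qed
  moreover have "0 < perron ?M" by (rule perron_pencil_ge(3)[OF posA]) simp
  ultimately show ?thesis by (auto simp: admissible_def c ln_mult zero_ereal_def)
qed

lemma unique_dual_minimizerI:
  fixes A B :: "real^2^2"
  assumes p: "0 < p" "p < 1"
    and A: "\<And>i j. A $ i $ j = exp (k 1 i j)" and B: "\<And>i j. B $ i $ j = exp (k 2 i j)"
    and c: "\<And>x y. c (x, y) = k x (y 0) (y 1)"
    and s: "0 < s" "\<And>t. 0 < t \<Longrightarrow> dual_value p A B s \<le> dual_value p A B t"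
    and r: "r = perron (A + s *\<^sub>R B)"
  shows "unique_dual_minimizer (two_point_measure p) c (neg_log_pair (1 / r, s / r))"
proof -
  have posA: "0 < A $ i $ j" "0 < B $ i $ j" for i j by (simp_all add: A B)
  note adm = admissible_iff[of A k B c, OF A B c]
  have r0: "0 < r" unfolding r by (rule perron_pencil_ge(3)[OF posA]) (use s in simp)
  let ?\<phi> = "neg_log_pair (1 / r, s / r)"
  let ?J = "\<lambda>\<phi>. \<integral>x. \<phi> x \<partial>two_point_measure p"
  have \<phi>: "?\<phi> 1 = ln r" "?\<phi> 2 = ln r - ln s" using r0 s(1) by (simp_all add: neg_log_pair_def ln_div)
  have J: "?J \<psi> = dual_value p A B (exp (\<psi> 1 - \<psi> 2))" if "admissible c \<psi>" for \<psi>
    using that p unfolding adm by (simp add: integral_two_point_measure dual_value_def algebra_simps)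
  have adm_\<phi>: "admissible c ?\<phi>" unfolding adm \<phi> using s(1) by (simp add: r)
  have J_\<phi>: "?J ?\<phi> = dual_value p A B s" using J[OF adm_\<phi>] s(1) by (simp add: \<phi>)
  show ?thesis unfolding unique_dual_minimizer_def
  proof (intro allI iffI)
    fix \<psi> assume "is_arg_min ?J (admissible c) \<psi>"
    then have a: "admissible c \<psi>" and "\<not> ?J ?\<phi> < ?J \<psi>"
      using adm_\<phi> by (auto simp: is_arg_min_def)
    then have "dual_value p A B (exp (\<psi> 1 - \<psi> 2)) \<le> dual_value p A B s" by (simp add: J J_\<phi>)
    then have e: "exp (\<psi> 1 - \<psi> 2) = s"
      by (intro dual_value_min_unique[OF posA s]) auto
    then have "\<psi> 1 - \<psi> 2 = ln s" by (metis ln_exp)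
    moreover have "\<psi> 1 = ln r" using a unfolding adm e r .
    ultimately have "\<psi> x = ?\<phi> x" for x using exhaust_2[of x] \<phi> by auto
    then show "\<psi> = ?\<phi>" by auto
  next
    fix \<psi> assume "\<psi> = ?\<phi>"
    then show "is_arg_min ?J (admissible c) \<psi>"
      using s(2) by (auto simp: is_arg_min_def adm_\<phi> J_\<phi> J not_less)
  qed
qed

text \<open>
  Minimizing over a subset of the positive quadrant that contains the overall minimizer leaves it unchanged.
\<close>

lemma unique_dual_minimizer_restrict:
  assumes p: "0 \<le> p" "p \<le> 1"
    and u: "unique_dual_minimizer (two_point_measure p) c (neg_log_pair z)"
    and z: "z \<in> S" "0 < fst z" "0 < snd z"
  shows "is_arg_min (\<lambda>(w1, w2). - p * ln w1 - (1 - p) * ln w2)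
      (\<lambda>w. w \<in> S \<and> 0 < fst w \<and> 0 < snd w \<and> admissible c (neg_log_pair w)) w \<longleftrightarrow> w = z"
proof -
  let ?J = "\<lambda>\<phi>. \<integral>x. \<phi> x \<partial>two_point_measure p"
  let ?P = "\<lambda>w. w \<in> S \<and> 0 < fst w \<and> 0 < snd w \<and> admissible c (neg_log_pair w)"
  have obj: "(case w of (w1, w2) \<Rightarrow> - p * ln w1 - (1 - p) * ln w2) = ?J (neg_log_pair w)" for w
    using p by (simp add: integral_two_point_measure neg_log_pair_def split: prod.split)
  have min: "is_arg_min ?J (admissible c) \<psi> \<longleftrightarrow> \<psi> = neg_log_pair z" for \<psi>
    using u by (simp add: unique_dual_minimizer_def)
  have zmin: "admissible c (neg_log_pair z)" "\<And>\<psi>. admissible c \<psi> \<Longrightarrow> \<not> ?J \<psi> < ?J (neg_log_pair z)"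
    using min[of "neg_log_pair z"] by (auto simp: is_arg_min_def)
  show ?thesis unfolding obj
  proof
    assume w: "is_arg_min (\<lambda>w. ?J (neg_log_pair w)) ?P w"
    then have "\<not> ?J (neg_log_pair z) < ?J (neg_log_pair w)" using z zmin(1) unfolding is_arg_min_def by blast
    then have "is_arg_min ?J (admissible c) (neg_log_pair w)"
      using w zmin(2) unfolding is_arg_min_def by (meson less_le_trans linorder_not_less)
    then have e: "neg_log_pair w = neg_log_pair z" by (simp add: min)
    have "0 < fst w" "0 < snd w" using w by (auto simp: is_arg_min_def)
    with fun_cong[OF e, of 1] fun_cong[OF e, of 2] z show "w = z"
      by (simp add: neg_log_pair_def prod_eq_iff)
  next
    assume "w = z"
    then show "is_arg_min (\<lambda>w. ?J (neg_log_pair w)) ?P w"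
      using z zmin by (auto simp: is_arg_min_def)
  qed
qed

lemma binary_gibbs_inequality:
  fixes p q :: real
  assumes "0 < p" "p < 1" "0 < q" "q < 1"
  shows "- p * ln p - (1 - p) * ln (1 - p) \<le> - p * ln q - (1 - p) * ln (1 - q)"
proof -
  have "p * ln (q / p) \<le> p * (q / p - 1)" using assms by (intro mult_left_mono ln_le_minus_one) auto
  moreover have "(1 - p) * ln ((1 - q) / (1 - p)) \<le> (1 - p) * ((1 - q) / (1 - p) - 1)"
    using assms by (intro mult_left_mono ln_le_minus_one) auto
  moreover have "p * (q / p - 1) + (1 - p) * ((1 - q) / (1 - p) - 1) = 0" using assms by (simp add: field_simps)
  ultimately have "p * ln (q / p) + (1 - p) * ln ((1 - q) / (1 - p)) \<le> 0" by linarith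
  then show ?thesis using assms by (simp add: ln_div algebra_simps)
qed

lemma perron_stochastic_pencil:
  assumes A: "column_stochastic A" "\<And>i j. 0 < A $ i $ j" and B: "column_stochastic B" "\<And>i j. 0 < B $ i $ j" and s: "0 < s"
  shows "perron (A + s *\<^sub>R B) = 1 + s"
proof (rule perron_unique[where h = "\<lambda>_. 1"])
  show "0 < (A + s *\<^sub>R B) $ i $ j" for i j using pencil_pos[OF A(2) B(2)] s by simp
  show "(\<Sum>i\<in>UNIV. 1 * (A + s *\<^sub>R B) $ i $ j) = (1 + s) * 1" for j
    using A(1) B(1) by (simp add: column_stochastic_def sum.distrib sum_distrib_left[symmetric])
qed simp

text \<open>
  For \<open>0 < q < 1\<close> the weights \<open>q C\<^sup>1\<close> and \<open>(1 - q) C\<^sup>2\<close> give the upper bound \<open>- p ln q - (1 - p) ln (1 - q)\<close>. Take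
  \<open>q = p\<close>, or let \<open>q\<close> tend to \<open>p\<close> if \<open>p\<close> is \<open>0\<close> or \<open>1\<close>; in these cases the value is \<open>0\<close> since
  \<open>ln 1 = 0\<close> and the other term has the factor \<open>0\<close>. The Gibbs plan of the
  weights at \<open>q = p\<close> has the required marginal and attains the value.
\<close>

lemma constrained_pressure_stochastic:
  assumes p: "0 \<le> p" "p \<le> 1"
    and C: "\<And>x i j. C x $ i $ j = exp (k x i j)" and c: "\<And>x y. c (x, y) = k x (y 0) (y 1)"
    and st: "\<And>x. column_stochastic (C x)"
  shows "constrained_pressure (two_point_measure p) c = ereal (- p * ln p - (1 - p) * ln (1 - p))"
proof -
  define v where "v = - p * ln p - (1 - p) * ln (1 - p)"
  have col: "(\<Sum>i\<in>UNIV. exp (k x i j)) = 1" for x j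
    using st[of x] by (simp add: column_stochastic_def C)
  have cf: "c = (\<lambda>(x, y). k x (y 0) (y 1))" using c by auto
  have le_q: "(\<integral>z. c z \<partial>\<pi>) + plan_entropy \<pi> \<le> - p * ln q - (1 - p) * ln (1 - q)"
    if \<pi>: "\<pi> \<in> invariant_plans_over (two_point_measure p)" and q: "0 < q" "q < 1" for \<pi> q
  proof -
    have inv: "\<pi> \<in> invariant_plans" and mu: "distr \<pi> (count_space UNIV) fst = two_point_measure p"
      using \<pi> by (auto simp: invariant_plans_over_def marginal_symbol_def)
    define z where "z x = (if x = 1 then q else 1 - q)" for x :: 2
    have z: "0 < z x" for x using q by (simp add: z_def)
    have fst_m: "fst \<in> measurable \<pi> (count_space UNIV)"
      using measurable_cong_sets[OF sets_plan[OF inv] refl] unfolding plan_space_def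
      by (metis measurable_fst)
    have "(\<integral>z. c z \<partial>\<pi>) + plan_entropy \<pi> \<le> (\<integral>(x, y). k x (y 0) (y 1) - ln (z x * exp (k x (y 0) (y 1))) \<partial>\<pi>)"
      unfolding cf
    proof (rule integral_plus_entropy_le[OF inv])
      show "0 < z x * exp (k x i j)" for x i j using z by simp
      show "(\<Sum>x\<in>UNIV. \<Sum>i\<in>UNIV. z x * exp (k x i j)) = 1" for j
        by (simp only: sum_distrib_left[symmetric] col) (simp add: z_def sum_2)
    qed
    also have "\<dots> = (\<integral>u. - ln (z (fst u)) \<partial>\<pi>)"
      using z by (intro Bochner_Integration.integral_cong refl) (auto simp: ln_mult less_imp_neq[THEN not_sym])
    also have "\<dots> = (\<integral>x. - ln (z x) \<partial>two_point_measure p)"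
      unfolding mu[symmetric] by (rule integral_distr[OF fst_m, symmetric]) simp
    also have "\<dots> = - p * ln q - (1 - p) * ln (1 - q)"
      using p by (subst integral_two_point_measure) (simp_all add: z_def)
    finally show ?thesis .
  qed
  have upper: "(\<integral>z. c z \<partial>\<pi>) + plan_entropy \<pi> \<le> v" if \<pi>: "\<pi> \<in> invariant_plans_over (two_point_measure p)" for \<pi>
  proof -
    let ?x = "(\<integral>z. c z \<partial>\<pi>) + plan_entropy \<pi>"
    consider "0 < p \<and> p < 1" | "p = 0" | "p = 1" using p by linarith
    then show ?thesis
    proof cases
      case 1
      then show ?thesis using le_q[OF \<pi>, of p] by (simp add: v_def)
    next
      case 2
      have "?x \<le> 0"
      proof (rule ccontr)
        assume x: "\<not> ?x \<le> 0"
        define q where "q = exp (- (?x / 2))"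
        have q: "0 < q" "q < 1" "ln q = - (?x / 2)" using x by (simp_all add: q_def)
        have "?x \<le> - ln q" using le_q[OF \<pi>, of "1 - q"] q(1,2) 2 by simp
        then have "?x \<le> ?x / 2" by (simp only: q(3) minus_minus)
        then show False using x by simp
      qed
      then show ?thesis using 2 by (simp add: v_def)
    next
      case 3
      have "?x \<le> 0"
      proof (rule ccontr)
        assume x: "\<not> ?x \<le> 0"
        define q where "q = exp (- (?x / 2))"
        have q: "0 < q" "q < 1" "ln q = - (?x / 2)" using x by (simp_all add: q_def)
        have "?x \<le> - ln q" using le_q[OF \<pi>, of "q"] q(1,2) 3 by simp
        then have "?x \<le> ?x / 2" by (simp only: q(3) minus_minus)
        then show False using x by simp
      qed
      then show ?thesis using 3 by (simp add: v_def)
    qed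
  qed
  have lower: "\<exists>\<pi>\<in>invariant_plans_over (two_point_measure p). (\<integral>z. c z \<partial>\<pi>) + plan_entropy \<pi> = v"
  proof -
    define z where "z x = (if x = 1 then p else 1 - p)" for x :: 2
    have z: "0 \<le> z x" for x using p by (simp add: z_def)
    define w where "w x i j = z x * exp (k x i j)" for x i j
    have w: "0 \<le> w x i j" for x i j using z by (simp add: w_def)
    have w_pos: "0 < (\<Sum>x\<in>UNIV. w x i j)" for i j
      using p by (cases "p = 0") (auto simp: w_def z_def sum_2 intro!: add_pos_nonneg)
    have wi: "(\<Sum>i\<in>UNIV. w x i j) = z x" for x j
      by (simp add: w_def sum_distrib_left[symmetric] col)
    have w1: "(\<Sum>x\<in>UNIV. \<Sum>i\<in>UNIV. w x i j) = 1" for j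
      unfolding wi by (simp add: z_def sum_2)
    obtain \<pi> \<nu> where inv: "\<pi> \<in> invariant_plans" and \<nu>: "(\<Sum>i\<in>UNIV. \<nu> i) = 1"
      and int: "\<And>g. (\<integral>(x, y). g x (y 0) (y 1) \<partial>\<pi>) = (\<Sum>x\<in>UNIV. \<Sum>i\<in>UNIV. \<Sum>j\<in>UNIV. g x i j * (w x i j * \<nu> j))"
      and jac: "\<And>x y. jac \<pi> (x, y) = w x (y 0) (y 1)"
      by (rule gibbs_plan_exists[of w, OF w w_pos w1]) (rule that)
    interpret prob_space \<pi> by (rule invariant_plansD[OF inv])
    have marg: "(\<Sum>i\<in>UNIV. \<Sum>j\<in>UNIV. w x i j * \<nu> j) = z x" for x
      by (subst sum.swap) (simp add: sum_distrib_right[symmetric] sum_distrib_left[symmetric] wi \<nu>)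
    have intf: "(\<integral>(x, y). g x \<partial>\<pi>) = (\<Sum>x\<in>UNIV. g x * z x)" for g
      using int[of "\<lambda>x i j. g x"] by (simp add: sum_distrib_left[symmetric] marg)
    have fst_m: "fst \<in> measurable \<pi> (count_space UNIV)"
      using measurable_cong_sets[OF sets_plan[OF inv] refl] unfolding plan_space_def
      by (metis measurable_fst)
    have "marginal_symbol \<pi> = two_point_measure p"
      unfolding marginal_symbol_def
    proof (rule measure_eqI_countable[where A = UNIV])
      fix x :: 2
      have ind: "(indicator (fst -` {x}) u :: real) = (case u of (x', y) \<Rightarrow> indicator {x} x')" for u :: "2 \<times> seq"
        by (cases u) (simp add: indicator_def)
      have "measure \<pi> (fst -` {x}) = (\<integral>u. indicator (fst -` {x}) u \<partial>\<pi>)"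
        by (simp add: space_plan[OF inv])
      also have "\<dots> = (\<integral>(x', y). indicator {x} x' \<partial>\<pi>)" unfolding ind ..
      also have "\<dots> = z x" unfolding intf by (simp add: indicator_def if_distrib cong: if_cong)
      finally have "measure \<pi> (fst -` {x}) = z x" .
      then show "emeasure (distr \<pi> (count_space UNIV) fst) {x} = emeasure (two_point_measure p) {x}"
        using emeasure_distr[OF fst_m, of "{x}"]
        by (simp add: space_plan[OF inv] emeasure_eq_measure two_point_measure_def emeasure_point_measure_finite z_def)
    qed (simp_all add: two_point_measure_def sets_point_measure)
    then have over: "\<pi> \<in> invariant_plans_over (two_point_measure p)"
      using inv by (simp add: invariant_plans_over_def)
    have "plan_entropy \<pi> = - (\<integral>(x, y). ln (w x (y 0) (y 1)) \<partial>\<pi>)"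
      using jac[of "fst z" "snd z" for z] by (simp add: plan_entropy_def case_prod_beta')
    then have "(\<integral>z. c z \<partial>\<pi>) + plan_entropy \<pi> =
      (\<Sum>x\<in>UNIV. \<Sum>i\<in>UNIV. \<Sum>j\<in>UNIV. k x i j * (w x i j * \<nu> j) - ln (w x i j) * (w x i j * \<nu> j))"
      unfolding cf using int[of k] int[of "\<lambda>x i j. ln (w x i j)"] by (simp add: sum_subtractf)
    also have "\<dots> = (\<Sum>x\<in>UNIV. \<Sum>i\<in>UNIV. \<Sum>j\<in>UNIV. - ln (z x) * (w x i j * \<nu> j))"
    proof (intro sum.cong refl)
      fix x i j :: 2
      show "k x i j * (w x i j * \<nu> j) - ln (w x i j) * (w x i j * \<nu> j) = - ln (z x) * (w x i j * \<nu> j)"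
      proof (cases "z x = 0")
        case False
        then have "ln (w x i j) = ln (z x) + k x i j" using z[of x] by (simp add: w_def ln_mult)
        then show ?thesis by (simp add: algebra_simps)
      qed (simp add: w_def)
    qed
    also have "\<dots> = (\<Sum>x\<in>UNIV. - ln (z x) * z x)"
      by (simp only: sum_distrib_left[symmetric] marg)
    also have "\<dots> = v" by (simp add: sum_2 z_def v_def)
    finally show ?thesis using over by blast
  qed
  show ?thesis
    unfolding constrained_pressure_def v_def[symmetric]
    using upper lower by (intro antisym SUP_least) (auto intro!: SUP_upper2)
qed

section \<open>The dual minimizer as an intersection of conics\<close>

theorem theorem6:
  fixes p \<theta> a b \<gamma> \<delta> \<epsilon> :: real
    and c :: "2 \<times> (nat \<Rightarrow> 2) \<Rightarrow> real" and k :: "2 \<Rightarrow> 2 \<Rightarrow> 2 \<Rightarrow> real"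
    and C :: "2 \<Rightarrow> real^2^2" and C12 C21 :: "real^2^2"
    and S :: "(real \<times> real) set"
  assumes p: "0 \<le> p" "p \<le> 1"
    and theta: "0 < \<theta>" "\<theta> < 1"
    and lipschitz: "lipschitz_cost \<theta> c"
    and two_coordinates: "\<And>x y. c (x, y) = k x (y 0) (y 1)"
    and C: "\<And>x i j. C x $ i $ j = exp (k x i j)"
    and C12: "C12 = vector [C 1 $ 1, C 2 $ 2]"
    and C21: "C21 = vector [C 2 $ 1, C 1 $ 2]"
    and a: "a = det (C 1)"
    and b: "b = det (C 2)"
    and gamma: "\<gamma> = det C12 + det C21"
    and delta: "\<delta> = - trace (C 1)"
    and epsilon: "\<epsilon> = - trace (C 2)"
    and S: "S = {(z1, z2).
        a * z1\<^sup>2 + b * z2\<^sup>2 + \<gamma> * z1 * z2 + \<delta> * z1 + \<epsilon> * z2 + 1 = 0 \<and>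
        2 * b * p * z2\<^sup>2 - 2 * a * (1 - p) * z1\<^sup>2 + \<gamma> * (2 * p - 1) * z1 * z2
          + \<epsilon> * p * z2 - \<delta> * (1 - p) * z1 = 0}"
  shows "(0 < p \<and> p < 1 \<longrightarrow>
           finite S \<and> card S \<le> 4 \<and>
           (\<exists>z1 z2. (z1, z2) \<in> S \<and> 0 < z1 \<and> 0 < z2 \<and>
              unique_dual_minimizer (two_point_measure p) c (neg_log_pair (z1, z2)) \<and>
              (\<forall>w. is_arg_min (\<lambda>(w1, w2). - p * ln w1 - (1 - p) * ln w2)
                     (\<lambda>w. w \<in> S \<and> 0 < fst w \<and> 0 < snd w \<and> admissible c (neg_log_pair w)) w
                   \<longleftrightarrow> w = (z1, z2)))) \<and>
         (column_stochastic (C 1) \<and> column_stochastic (C 2) \<longrightarrow>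
           (0 < p \<and> p < 1 \<longrightarrow>
             unique_dual_minimizer (two_point_measure p) c (neg_log_pair (p, 1 - p))) \<and>
           constrained_pressure (two_point_measure p) c = ereal (- p * ln p - (1 - p) * ln (1 - p)))"
proof (intro conjI impI)
  have entry: "C 1 $ i $ j = exp (k 1 i j)" "C 2 $ i $ j = exp (k 2 i j)" for i j by (simp_all add: C)
  have pos: "0 < C 1 $ i $ j" "0 < C 2 $ i $ j" for i j by (simp_all add: C)
  have det: "det (C 1 + s *\<^sub>R C 2) = det (C 1) + \<gamma> * s + det (C 2) * s\<^sup>2" for s
    by (simp add: gamma C12 C21 det_2 vector_2 algebra_simps power2_eq_square)
  have tr: "trace (C 1 + s *\<^sub>R C 2) = trace (C 1) + s * trace (C 2)" for s
    by (simp add: trace_def sum_2 algebra_simps)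
  note minimizer = unique_dual_minimizerI[of p "C 1" k "C 2" c, OF _ _ entry two_coordinates]
  {
    assume p01: "0 < p \<and> p < 1"
    have "0 < trace (C 1)" "0 < trace (C 2)" using pos by (simp_all add: trace_def sum_2 add_pos_pos)
    then have "\<delta> < 0" "\<epsilon> < 0" by (simp_all add: delta epsilon)
    moreover have "4 * a < \<delta>\<^sup>2" "4 * b < \<epsilon>\<^sup>2"
      using perron_disc[of "C 1"] perron_disc[of "C 2"] pos by (simp_all add: a b delta epsilon)
    ultimately have "finite S \<and> card S \<le> 4"
      using p01 by (intro conics_card_le[OF _ _ _ _ _ _ S]) auto
    then show "finite S" "card S \<le> 4" by auto
    obtain s where s: "0 < s" "\<And>t. 0 < t \<Longrightarrow> dual_value p (C 1) (C 2) s \<le> dual_value p (C 1) (C 2) t"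
      using dual_value_attains_min[OF pos] p01 by blast
    define r where "r = perron (C 1 + s *\<^sub>R C 2)"
    have r0: "0 < r" unfolding r_def by (rule perron_pencil_ge(3)[OF pos]) (use s in simp)
    have u: "unique_dual_minimizer (two_point_measure p) c (neg_log_pair (1 / r, s / r))"
      by (rule minimizer[OF _ _ s r_def]) (use p01 in auto)
    have char: "r\<^sup>2 = (trace (C 1) + s * trace (C 2)) * r - (a + \<gamma> * s + b * s\<^sup>2)"
      using perron_char[OF pencil_pos[OF pos, of s]] s(1) by (simp add: r_def[symmetric] tr det a b)
    have stat: "(1 - p) * (2 * r\<^sup>2 - (trace (C 1) + s * trace (C 2)) * r) = s * (trace (C 2) * r - (\<gamma> + 2 * b * s))"
      unfolding b by (rule dual_value_stationary[OF pos s r_def det])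
    \<comment> \<open>the first conic is the characteristic equation of \<open>C\<^sup>1 + s C\<^sup>2\<close> divided by \<open>r\<^sup>2\<close>\<close>
    have "(a * (1 / r)\<^sup>2 + b * (s / r)\<^sup>2 + \<gamma> * (1 / r) * (s / r) + \<delta> * (1 / r) + \<epsilon> * (s / r) + 1) * r\<^sup>2
        = a + b * s\<^sup>2 + \<gamma> * s + \<delta> * r + \<epsilon> * s * r + r\<^sup>2"
      using r0 by (simp add: field_simps power2_eq_square)
    also have "\<dots> = 0" unfolding char by (simp add: delta epsilon algebra_simps)
    finally have F: "a * (1 / r)\<^sup>2 + b * (s / r)\<^sup>2 + \<gamma> * (1 / r) * (s / r) + \<delta> * (1 / r) + \<epsilon> * (s / r) + 1 = 0"
      using r0 by simp
    \<comment> \<open>the second one is the stationarity condition, after eliminating \<open>r\<^sup>2\<close>\<close>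
    have "(2 * b * p * (s / r)\<^sup>2 - 2 * a * (1 - p) * (1 / r)\<^sup>2 + \<gamma> * (2 * p - 1) * (1 / r) * (s / r)
        + \<epsilon> * p * (s / r) - \<delta> * (1 - p) * (1 / r)) * r\<^sup>2
        = 2 * b * p * s\<^sup>2 - 2 * a * (1 - p) + \<gamma> * (2 * p - 1) * s + \<epsilon> * p * s * r - \<delta> * (1 - p) * r"
      using r0 by (simp add: field_simps power2_eq_square)
    also have "\<dots> = (1 - p) * (2 * r\<^sup>2 - (trace (C 1) + s * trace (C 2)) * r) - s * (trace (C 2) * r - (\<gamma> + 2 * b * s))"
      unfolding char delta epsilon by (simp add: algebra_simps power2_eq_square)
    also have "\<dots> = 0" using stat by simp
    finally have G: "2 * b * p * (s / r)\<^sup>2 - 2 * a * (1 - p) * (1 / r)\<^sup>2 + \<gamma> * (2 * p - 1) * (1 / r) * (s / r)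
        + \<epsilon> * p * (s / r) - \<delta> * (1 - p) * (1 / r) = 0"
      using r0 by simp
    have inS: "(1 / r, s / r) \<in> S" using F G by (simp add: S)
    show "\<exists>z1 z2. (z1, z2) \<in> S \<and> 0 < z1 \<and> 0 < z2 \<and>
              unique_dual_minimizer (two_point_measure p) c (neg_log_pair (z1, z2)) \<and>
              (\<forall>w. is_arg_min (\<lambda>(w1, w2). - p * ln w1 - (1 - p) * ln w2)
                     (\<lambda>w. w \<in> S \<and> 0 < fst w \<and> 0 < snd w \<and> admissible c (neg_log_pair w)) w
                   \<longleftrightarrow> w = (z1, z2))"
      using inS u unique_dual_minimizer_restrict[OF p u inS] r0 s(1)
      by (intro exI[of _ "1 / r"] exI[of _ "s / r"]) simp
  }
  assume st: "column_stochastic (C 1) \<and> column_stochastic (C 2)"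
  have "column_stochastic (C x)" for x using st exhaust_2[of x] by auto
  then show "constrained_pressure (two_point_measure p) c = ereal (- p * ln p - (1 - p) * ln (1 - p))"
    by (rule constrained_pressure_stochastic[OF p C two_coordinates])
  assume p01: "0 < p \<and> p < 1"
  have r: "perron (C 1 + t *\<^sub>R C 2) = 1 + t" if "0 < t" for t
    using st pos that by (intro perron_stochastic_pencil) auto
  define s where "s = (1 - p) / p"
  have s: "0 < s" "1 + s = 1 / p" using p01 by (simp_all add: s_def field_simps)
  have dv: "dual_value p (C 1) (C 2) t = - p * ln (1 / (1 + t)) - (1 - p) * ln (1 - 1 / (1 + t))" if "0 < t" for t
  proof -
    have e: "1 - 1 / (1 + t) = t / (1 + t)" using that by (simp add: field_simps)
    show ?thesis unfolding e using that by (simp add: dual_value_def r ln_div algebra_simps)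
  qed
  have "unique_dual_minimizer (two_point_measure p) c (neg_log_pair (1 / (1 / p), s / (1 / p)))"
  proof (rule minimizer[OF _ _ s(1)])
    fix t :: real assume t: "0 < t"
    have "dual_value p (C 1) (C 2) s = - p * ln p - (1 - p) * ln (1 - p)" unfolding dv[OF s(1)] s(2) by simp
    also have "\<dots> \<le> dual_value p (C 1) (C 2) t"
      unfolding dv[OF t] by (rule binary_gibbs_inequality) (use p01 t in auto)
    finally show "dual_value p (C 1) (C 2) s \<le> dual_value p (C 1) (C 2) t" .
  qed (use p01 s in \<open>simp_all add: r\<close>)
  moreover have "s / (1 / p) = 1 - p" using p01 by (simp add: s_def)
  ultimately show "unique_dual_minimizer (two_point_measure p) c (neg_log_pair (p, 1 - p))" by simp
qed

end
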